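(* Let $0<\alpha<\tfrac12$. Let $V_\alpha\subset \mathbb R\times[-\infty,0]$, the planar map $\hat F_\alpha:V_\alpha\to V_\alpha$ and the $\alpha$-Farey map $F_\alpha$ be as defined in the context. Let $\mu_\alpha$ be the measure on $V_\alpha$ with density $\dfrac{dx\,dy}{(x-y)^2}$, and let $\nu_\alpha$ be the projection of $\mu_\alpha$ to the first coordinate. Then the dynamical system $(V_\alpha,\hat F_\alpha,\mu_\alpha)$ is a representation of the natural extension of $\big([\alpha-1,\tfrac1\alpha),F_\alpha,\nu_\alpha\big)$.
   Context: Sets and maps are considered up to Lebesgue null sets. The measures may be infinite ($\sigma$-finite). Natural extension: $(V,\hat F,\mu)$ represents the natural extension of $(I,F,\nu)$ via the first-coordinate projection $\pi_1$ if $\hat F$ is bijective on $V$ up to null sets and preserves $\mu$, $\pi_1\circ\hat F=F\circ\pi_1$ a.e., $\nu=\mu\circ\pi_1^{-1}$, and the Borel $\sigma$-algebra of $V$ is, modulo null sets, generated by $\bigvee_{n\ge 0}\hat F^{n}\pi_1^{-1}\mathcal B(I)$. $\alpha$-Farey map on $[\alpha-1,\frac1\alpha]$: $F_\alpha(x)=-\frac{x}{1+x}$ if $\alpha-1\le x<0$; $F_\alpha(x)=\frac{x}{1-x}$ if $0\le x\le\frac1{1+\alpha}$; $F_\alpha(x)=\frac{1-x}{x}$ if $\frac1{1+\alpha}<x\le\frac1\alpha$. Planar map: $\hat F_\alpha(x,y)=\left(-\frac{x}{1+x},-\frac{y}{1+y}\right)$ if $\alpha-1\le x<0$; $\left(\frac{x}{1-x},\frac{y}{1-y}\right)$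 if $0\le x<\frac1{1+\alpha}$; $\left(\frac{1-x}{x},\frac{1-y}{y}\right)$ if $\frac1{1+\alpha}\le x<\frac1\alpha$ (with the usual conventions at $y=-\infty$). The domain $\Omega_\alpha$: for $x\in[\alpha-1,\alpha)$, $x\ne0$, put $b(x)=\lfloor \frac1{|x|}+1-\alpha\rfloor$ and let $\hat G_\alpha(x,y)=\left(-\frac1x-b(x),\frac1{b(x)-y}\right)$ for $x<0$ and $\hat G_\alpha(x,y)=\left(\frac1x-b(x),\frac1{b(x)+y}\right)$ for $x>0$. $\Omega_\alpha\subset[\alpha-1,\alpha]\times[0,1]$ is the closure of $\{\hat G_\alpha^n(x,0): x\in[\alpha-1,\alpha),\ n\ge0\}$ (over all $n$ for which the iterate is defined). (It is known that $\hat G_\alpha$ is bijective on $\Omega_\alpha$ up to null sets and is a natural extension of the $\alpha$-continued fraction map.) Put $\Omega_\alpha^*=\{(x,y):(x,-\frac1y)\in\Omega_\alpha\}$. Let $k_0$ be the integer with $\frac1{k_0+\alpha}\le\alpha<\frac1{k_0-1+\alpha}$. Cylinders: $\Omega^*_{\alpha,k_0,+}=\{(x,y)\in\Omega^*_\alpha:\frac1{k_0+\alpha}<x<\alpha\}$; $\Omega^*_{\alpha,k,+}=\{(x,y)\in\Omega^*_\alpha:\frac1{k+\alpha}<x\le\frac1{k-1+\alpha}\}$ for $k>k_0$; $\Omega^*_{\alpha,k,+}=\emptyset$ for $2\le k<k_0$; $\Omega^*_{\alpha,2,-}=\{(x,y)\in\Omega^*_\alpha:\alpha-1<x\le-\frac1{2+\alpha}\}$;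 $\Omega^*_{\alpha,k,-}=\{(x,y)\in\Omega^*_\alpha:-\frac1{k-1+\alpha}<x\le-\frac1{k+\alpha}\}$ for $k\ge3$. Put $\hat\Omega_{\alpha,k,-}=\{(x,y):(-\frac1x,-\frac1y)\in\Omega^*_{\alpha,k,-}\}$ and $\hat\Omega_{\alpha,k,+}=\{(x,y):(\frac1x,\frac1y)\in\Omega^*_{\alpha,k,+}\}$. For $j\ge1$ put $$\Upsilon_{\alpha,j}=\bigcup_{k\ge j+1}\big(\hat\Omega_{\alpha,k,-}-(k-j,k-j)\big)\cup\bigcup_{k\ge j+1}\big(\hat\Omega_{\alpha,k,+}-(k-j,k-j)\big),$$ $\Upsilon_\alpha=\bigcup_{j\ge1}\Upsilon_{\alpha,j}$, $(\Upsilon_\alpha)^{-1}=\{(x,y):(\frac1x,\frac1y)\in\Upsilon_\alpha\}$, and finally $V_\alpha=\Omega^*_\alpha\cup(\Upsilon_\alpha)^{-1}$. *)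

theory Defs
  imports "HOL-Analysis.Analysis"
begin

section \<open>Natural extensions of measure-theoretic dynamical systems\<close>

definition eq_mod_null :: "'a measure \<Rightarrow> 'a set \<Rightarrow> 'a set \<Rightarrow> bool" where
  "eq_mod_null M A B \<longleftrightarrow> (\<exists>Z\<in>null_sets M. (A - B) \<union> (B - A) \<subseteq> Z)"

definition preserves_measure :: "'a measure \<Rightarrow> ('a \<Rightarrow> 'a) \<Rightarrow> bool" where
  "preserves_measure M T \<longleftrightarrow>
     (\<forall>A\<in>sets M. T -` A \<inter> space M \<in> sets M \<and> emeasure M (T -` A \<inter> space M) = emeasure M A)"

text \<open>The sigma-algebra on \<open>X\<close> generated by the sets \<open>T\<^sup>n (p\<^sup>-\<^sup>1 B)\<close>, with \<open>n \<ge> 0\<close> and \<open>B\<close>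
  measurable in the factor. Here \<open>X\<close> is a set that \<open>T\<close> maps bijectively onto itself.\<close>

definition past_sigma_algebra ::
  "('a \<Rightarrow> 'b) \<Rightarrow> ('a \<Rightarrow> 'a) \<Rightarrow> 'a set \<Rightarrow> 'b measure \<Rightarrow> 'a set set" where
  "past_sigma_algebra p T X N =
     sigma_sets X {(T ^^ n) ` (p -` B \<inter> X) | n B. B \<in> sets N}"

text \<open>\<open>(M, T)\<close> represents the natural extension of \<open>(N, F)\<close> via \<open>p\<close>. The measures may be infinite,
  and maps need to behave well only almost everywhere: \<open>T\<close> and \<open>p\<close> may send a null set of
  points outside \<open>space M\<close> and \<open>space N\<close>, respectively. The set \<open>X\<close> is a subset of full measure
  on which \<open>T\<close> is genuinely a bijection.\<close>

definition represents_natural_extension ::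
  "('a \<Rightarrow> 'b) \<Rightarrow> 'a measure \<Rightarrow> ('a \<Rightarrow> 'a) \<Rightarrow> 'b measure \<Rightarrow> ('b \<Rightarrow> 'b) \<Rightarrow> bool" where
  "represents_natural_extension p M T N F \<longleftrightarrow>
     sigma_finite_measure M \<and> sigma_finite_measure N \<and>
     preserves_measure M T \<and>
     (AE v in M. p v \<in> space N) \<and>
     (AE v in M. p (T v) = F (p v)) \<and>
     (\<forall>B\<in>sets N. p -` B \<inter> space M \<in> sets M \<and> emeasure N B = emeasure M (p -` B \<inter> space M)) \<and>
     (\<exists>X\<in>sets M. space M - X \<in> null_sets M \<and> bij_betw T X X \<and>
        (\<forall>A\<in>sets M. \<exists>A'\<in>past_sigma_algebra p T X N. eq_mod_null M A A') \<and>
        (\<forall>A'\<in>past_sigma_algebra p T X N. \<exists>A\<in>sets M. eq_mod_null M A A'))"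


section \<open>The \<open>\<alpha>\<close>-Farey map and its planar extension\<close>

text \<open>Intended for \<open>\<alpha> - 1 \<le> x \<le> 1 / \<alpha>\<close>; values elsewhere are irrelevant.\<close>

definition farey :: "real \<Rightarrow> real \<Rightarrow> real" where
  "farey \<alpha> x =
     (if x < 0 then - x / (1 + x)
      else if x \<le> 1 / (1 + \<alpha>) then x / (1 - x)
      else (1 - x) / x)"

text \<open>Second coordinates range over \<open>[-\<infinity>, 0]\<close>, whose only infinite point is \<open>-\<infinity>\<close>. So a
  vanishing denominator gives \<open>-\<infinity>\<close>, unlike in \<^typ>\<open>ereal\<close>, where \<open>1 / 0 = \<infinity>\<close>.\<close>

definition quot :: "real \<Rightarrow> real \<Rightarrow> ereal" where
  "quot u v = (if v = 0 then - \<infinity> else ereal (u / v))"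

definition recip :: "ereal \<Rightarrow> ereal" where
  "recip y = (if y = 0 then - \<infinity> else 1 / y)"

text \<open>At \<open>y = -\<infinity>\<close> each of the three fractions in \<open>y\<close> below has the limit \<open>-1\<close>.
  Intended for \<open>\<alpha> - 1 \<le> x < 1 / \<alpha>\<close>.\<close>

definition farey_hat :: "real \<Rightarrow> real \<times> ereal \<Rightarrow> real \<times> ereal" where
  "farey_hat \<alpha> = (\<lambda>(x, y).
     let t = real_of_ereal y in
     if x < 0 then (- x / (1 + x), if y = - \<infinity> then - 1 else quot (- t) (1 + t))
     else if x < 1 / (1 + \<alpha>) then (x / (1 - x), if y = - \<infinity> then - 1 else quot t (1 - t))
     else ((1 - x) / x, if y = - \<infinity> then - 1 else quot (1 - t) t))"


section \<open>The domain of the planar map\<close>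

definition cf_digit :: "real \<Rightarrow> real \<Rightarrow> int" where
  "cf_digit \<alpha> x = \<lfloor>1 / \<bar>x\<bar> + 1 - \<alpha>\<rfloor>"

text \<open>Intended for \<open>x \<in> [\<alpha> - 1, \<alpha>)\<close> with \<open>x \<noteq> 0\<close>.\<close>

definition cf_hat :: "real \<Rightarrow> real \<times> real \<Rightarrow> real \<times> real" where
  "cf_hat \<alpha> = (\<lambda>(x, y).
     let b = of_int (cf_digit \<alpha> x) in
     if x < 0 then (- 1 / x - b, 1 / (b - y)) else (1 / x - b, 1 / (b + y)))"

text \<open>The iterate \<open>n\<close> is defined as long as no earlier first coordinate is \<open>0\<close>; the first
  coordinates automatically stay in \<open>[\<alpha> - 1, \<alpha>)\<close>.\<close>

definition Omega :: "real \<Rightarrow> (real \<times> real) set" where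
  "Omega \<alpha> = closure {(cf_hat \<alpha> ^^ n) (x, 0) | x n.
     \<alpha> - 1 \<le> x \<and> x < \<alpha> \<and> (\<forall>i<n. fst ((cf_hat \<alpha> ^^ i) (x, 0)) \<noteq> 0)}"

text \<open>In the next definitions \<open>recip (- y)\<close> stands for \<open>- 1 / y\<close>.\<close>

definition Omega_star :: "real \<Rightarrow> (real \<times> ereal) set" where
  "Omega_star \<alpha> = {(x, y). y \<le> 0 \<and> (\<exists>t. recip (- y) = ereal t \<and> (x, t) \<in> Omega \<alpha>)}"

definition k0 :: "real \<Rightarrow> nat" where
  "k0 \<alpha> = (THE k. 1 / (real k + \<alpha>) \<le> \<alpha> \<and> \<alpha> < 1 / (real k - 1 + \<alpha>))"

text \<open>Only \<open>k \<ge> 2\<close> is used for the cylinders.\<close>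

definition cyl_plus :: "real \<Rightarrow> nat \<Rightarrow> (real \<times> ereal) set" where
  "cyl_plus \<alpha> k =
     (if k < k0 \<alpha> then {}
      else if k = k0 \<alpha> then {(x, y) \<in> Omega_star \<alpha>. 1 / (real k + \<alpha>) < x \<and> x < \<alpha>}
      else {(x, y) \<in> Omega_star \<alpha>. 1 / (real k + \<alpha>) < x \<and> x \<le> 1 / (real k - 1 + \<alpha>)})"

definition cyl_minus :: "real \<Rightarrow> nat \<Rightarrow> (real \<times> ereal) set" where
  "cyl_minus \<alpha> k =
     (if k = 2 then {(x, y) \<in> Omega_star \<alpha>. \<alpha> - 1 < x \<and> x \<le> - 1 / (2 + \<alpha>)}
      else {(x, y) \<in> Omega_star \<alpha>. - 1 / (real k - 1 + \<alpha>) < x \<and> x \<le> - 1 / (real k + \<alpha>)})"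

definition Omega_hat_plus :: "real \<Rightarrow> nat \<Rightarrow> (real \<times> ereal) set" where
  "Omega_hat_plus \<alpha> k = {(x, y). (1 / x, recip y) \<in> cyl_plus \<alpha> k}"

definition Omega_hat_minus :: "real \<Rightarrow> nat \<Rightarrow> (real \<times> ereal) set" where
  "Omega_hat_minus \<alpha> k = {(x, y). (- 1 / x, recip (- y)) \<in> cyl_minus \<alpha> k}"

definition shift_down :: "real \<Rightarrow> (real \<times> ereal) set \<Rightarrow> (real \<times> ereal) set" where
  "shift_down c S = (\<lambda>(x, y). (x - c, y - ereal c)) ` S"

definition Upsilon_part :: "real \<Rightarrow> nat \<Rightarrow> (real \<times> ereal) set" where
  "Upsilon_part \<alpha> j =
     (\<Union>k\<in>{j + 1..}. shift_down (real k - real j) (Omega_hat_minus \<alpha> k)) \<union>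
     (\<Union>k\<in>{j + 1..}. shift_down (real k - real j) (Omega_hat_plus \<alpha> k))"

definition Upsilon :: "real \<Rightarrow> (real \<times> ereal) set" where
  "Upsilon \<alpha> = (\<Union>j\<in>{1..}. Upsilon_part \<alpha> j)"

definition Upsilon_inv :: "real \<Rightarrow> (real \<times> ereal) set" where
  "Upsilon_inv \<alpha> = {(x, y). y \<le> 0 \<and> (1 / x, recip y) \<in> Upsilon \<alpha>}"

definition V :: "real \<Rightarrow> (real \<times> ereal) set" where
  "V \<alpha> = Omega_star \<alpha> \<union> Upsilon_inv \<alpha>"


section \<open>The measures\<close>

text \<open>Lebesgue measure of the plane, transported to \<open>\<real> \<times> [-\<infinity>, \<infinity>]\<close>; the lines \<open>y = \<plusminus>\<infinity>\<close> are null.\<close>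

definition lborel_ext :: "(real \<times> ereal) measure" where
  "lborel_ext = distr lborel borel (\<lambda>(x :: real, y :: real). (x, ereal y))"

definition mu :: "real \<Rightarrow> (real \<times> ereal) measure" where
  "mu \<alpha> = restrict_space
     (density lborel_ext (\<lambda>(x, y). ennreal (1 / (x - real_of_ereal y)\<^sup>2))) (V \<alpha>)"

definition nu :: "real \<Rightarrow> real measure" where
  "nu \<alpha> = restrict_space (distr (mu \<alpha>) borel fst) {\<alpha> - 1..<1 / \<alpha>}"

end

theory Submission
  imports Defs
begin

text \<open>
  Everything is a diagonal Moebius action, and such maps preserve \<open>dx dy / (x - y)\<^sup>2\<close>. On the closed set
  \<open>\<Omega>\<^sub>\<alpha>\<close> the map of continued fractions is onto up to null sets, because every limit of orbit points
  with positive second coordinate is reached through finitely many inverse branches. Since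
  \<open>\<Omega>\<^sub>\<alpha>\<close> has finite measure, the images of the cylinders cannot overlap, so the map is also injective
  up to null sets. In the coordinates \<open>(1 / x, 1 / y)\<close> the Farey map subtracts \<open>(1, 1)\<close>, so
  \<open>V\<^sub>\<alpha>\<close> is the tower over \<open>\<Omega>\<^sup>*\<^sub>\<alpha>\<close> in which a point climbs down one level at a time; the floors are disjoint up to
  null sets by the injectivity on \<open>\<Omega>\<^sub>\<alpha>\<close>, and this makes the Farey map invertible. Finally, the
  past first coordinates determine the second one through a convergent continued fraction.
\<close>

section \<open>The invariant measure\<close>

text \<open>The delicate point is invertibility on all of \<open>V\<close>: the branch of the planar
  map must be recognised from the image point alone. The third branch lands in
  \<open>Omega_fin\<close>; off \<open>Omega_fin\<close> the sign of y + 1 separates the other two.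
  The only conflict is a first-branch image that falls back into \<open>Omega_fin\<close>. Such a
  point and its image would be two preimages of one point under the continued fraction map, so the
  conflict is null by the injectivity there. The multiplicity count behind that injectivity needs
  finite measure, so it is made on \<Omega> and not on \<open>V\<close>, whose measure may be
  infinite. The fibre coordinate is recovered without any uniform contraction rate: two of the three
  branches are isometries of the fibre, and r passages through the third give an error of at most 1
  / r. The arguments run in real coordinates at points avoiding a countable set of values; the
  conventions at interval ends, at poles and at y = -\<infinity> then concern null sets
  only.\<close>

lemma nn_integral_inverse_square_tail:
  fixes a c :: real
  assumes "c < a"
  shows "(\<integral>\<^sup>+y. ennreal (1 / (a - y)\<^sup>2) * indicator {..c} y \<partial>lborel) = ennreal (1 / (a - c))"
proof -
  have "(\<integral>\<^sup>+y. ennreal (1 / (a - y)\<^sup>2) * indicator {..c} y \<partial>lborel)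
      = (\<integral>\<^sup>+z. ennreal (1 / (a + z)\<^sup>2) * indicator {- c..} z \<partial>lborel)"
    by (subst nn_integral_real_affine[where c = "-1" and t = 0])
       (auto intro!: nn_integral_cong simp: indicator_def)
  also have "\<dots> = ennreal (0 - (- (1 / (a + - c))))"
  proof (rule nn_integral_FTC_atLeast)
    show "(\<lambda>z. 1 / (a + z)\<^sup>2) \<in> borel_measurable borel" by measurable
    show "((\<lambda>z. - (1 / (a + z))) has_real_derivative 1 / (a + x)\<^sup>2) (at x)" if "- c \<le> x" for x
      using that assms by (auto intro!: derivative_eq_intros simp: field_simps power2_eq_square)
    have "((\<lambda>z. - (1 / (a + z))) \<longlongrightarrow> - 0) at_top"
      by (intro tendsto_intros tendsto_divide_0[OF tendsto_const]
          filterlim_at_top_imp_at_infinity filterlim_tendsto_add_at_top[OF tendsto_const] filterlim_ident)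
    then show "((\<lambda>z. - (1 / (a + z))) \<longlongrightarrow> 0) at_top" by simp
  qed auto
  finally show ?thesis by simp
qed

text \<open>The substitution u = 1 / x across its pole, phrased for measures: agreement on bounded
  open intervals determines Lebesgue measure. Everything reduces to (0, b), whose preimage is the
  tail (1 / b, \<infinity>) of mass b; differences, reflection and a split at the null point 0 give
  the other intervals.\<close>

lemma distr_inverse_lborel:
  "distr (density lborel (\<lambda>x :: real. ennreal (1 / x\<^sup>2))) borel inverse = lborel" (is "?D = _")
proof -
  have D: "emeasure ?D A = (\<integral>\<^sup>+x. ennreal (1 / x\<^sup>2) * indicator (inverse -` A) x \<partial>lborel)"
    if "A \<in> sets borel" for A :: "real set"
  proof -
    have "inverse \<in> borel_measurable (borel :: real measure)" by measurable
    from measurable_sets_borel[OF this that] show ?thesis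
      using that by (simp add: emeasure_distr emeasure_density)
  qed
  have sing: "emeasure ?D {a} = 0" for a
  proof -
    have "inverse -` {a} = {inverse a}" by auto
    then show ?thesis
      by (subst D) (auto simp: nn_integral_indicator_singleton)
  qed
  have neg: "emeasure ?D (uminus ` A) = emeasure ?D A" if A: "A \<in> sets borel" for A :: "real set"
  proof -
    have im: "uminus ` A = uminus -` A" by force
    have "uminus \<in> borel_measurable (borel :: real measure)" by measurable
    from measurable_sets_borel[OF this A] have m: "uminus ` A \<in> sets borel" by (simp only: im)
    have "inverse \<in> borel_measurable (borel :: real measure)" by measurable
    from measurable_sets_borel[OF this A] have [measurable]: "inverse -` A \<in> sets borel" .
    have "emeasure ?D A = (\<integral>\<^sup>+x. ennreal (1 / x\<^sup>2) * indicator (inverse -` A) x \<partial>lborel)"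
      using A by (rule D)
    also have "\<dots> = (\<integral>\<^sup>+x. ennreal (1 / x\<^sup>2) * indicator (inverse -` A) (- x) \<partial>lborel)"
      by (subst nn_integral_real_affine[where c = "-1" and t = 0]) auto
    also have "\<dots> = (\<integral>\<^sup>+x. ennreal (1 / x\<^sup>2) * indicator (inverse -` (uminus ` A)) x \<partial>lborel)"
      unfolding im by (intro nn_integral_cong) (simp add: indicator_def)
    also have "\<dots> = emeasure ?D (uminus ` A)" using D[OF m] by simp
    finally show ?thesis by simp
  qed
  have pos0: "emeasure ?D {0<..<b} = ennreal b" if "0 < b" for b
  proof -
    have "emeasure ?D {0<..<b} = (\<integral>\<^sup>+x. ennreal (1 / x\<^sup>2) * indicator {1 / b<..} x \<partial>lborel)"
    proof (subst D)
      have "inverse -` {0<..<b} = {1 / b<..}"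
      proof (rule set_eqI)
        show "x \<in> inverse -` {0<..<b} \<longleftrightarrow> x \<in> {1 / b<..}" for x
          using that less_trans[of 0 "1 / b" x]
          by (cases "0 < x") (auto simp: field_simps)
      qed
      then show "(\<integral>\<^sup>+ x. ennreal (1 / x\<^sup>2) * indicator (inverse -` {0<..<b}) x \<partial>lborel)
          = (\<integral>\<^sup>+ x. ennreal (1 / x\<^sup>2) * indicator {1 / b<..} x \<partial>lborel)" by simp
    qed simp
    also have "\<dots> = (\<integral>\<^sup>+x. ennreal (1 / x\<^sup>2) * indicator {1 / b..} x \<partial>lborel)"
      using AE_lborel_singleton[of "1 / b"] by (intro nn_integral_cong_AE) (auto simp: indicator_def)
    also have "\<dots> = (\<integral>\<^sup>+x. ennreal (1 / (0 - x)\<^sup>2) * indicator {..- (1 / b)} x \<partial>lborel)"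
      by (subst nn_integral_real_affine[where c = "-1" and t = 0])
        (auto intro!: nn_integral_cong simp: indicator_def)
    also have "\<dots> = ennreal b" using that by (subst nn_integral_inverse_square_tail) auto
    finally show ?thesis .
  qed
  have pos: "emeasure ?D {a<..<b} = ennreal (b - a)" if "0 \<le> a" "a \<le> b" for a b
  proof (cases "a = 0 \<or> a = b")
    case True then show ?thesis using pos0[of b] that by (cases "b = 0") auto
  next
    case False
    then have ab: "0 < a" "a < b" using that by auto
    have "{0<..<b} = {0<..<a} \<union> {a} \<union> {a<..<b}" using ab by auto
    moreover have "ennreal b = emeasure ?D {0<..<b}" using pos0[of b] ab by simp
    ultimately have "ennreal b = emeasure ?D ({0<..<a} \<union> {a} \<union> {a<..<b})" by (simp only:)
    also have "\<dots> = emeasure ?D ({0<..<a} \<union> {a}) + emeasure ?D {a<..<b}"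
      by (rule plus_emeasure[symmetric]) auto
    also have "emeasure ?D ({0<..<a} \<union> {a}) = emeasure ?D {0<..<a} + emeasure ?D {a}"
      by (rule plus_emeasure[symmetric]) auto
    finally have *: "ennreal b = ennreal a + emeasure ?D {a<..<b}" using pos0[of a] ab sing by simp
    have "ennreal (b - a) = ennreal b - ennreal a" using ab by (simp add: ennreal_minus)
    then show ?thesis unfolding * by simp
  qed
  have "lborel = ?D"
  proof (rule lborel_eqI)
    fix l u :: real assume "\<And>b. b \<in> Basis \<Longrightarrow> l \<bullet> b \<le> u \<bullet> b"
    then have lu: "l \<le> u" by simp
    have "emeasure ?D {l<..<u} = ennreal (u - l)"
    proof -
      consider "0 \<le> l" | "u \<le> 0" | "l < 0" "0 < u" by linarith
      then show ?thesis
      proof cases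
        case 1 then show ?thesis using pos lu by simp
      next
        case 2
        then show ?thesis using neg[of "{-u<..<-l}"] pos[of "-u" "-l"] lu by simp
      next
        case 3
        have "{l<..<u} = {l<..<0} \<union> {0} \<union> {0<..<u}" using 3 by auto
        then have "emeasure ?D {l<..<u} = emeasure ?D ({l<..<0} \<union> {0} \<union> {0<..<u})" by simp
        also have "\<dots> = emeasure ?D ({l<..<0} \<union> {0}) + emeasure ?D {0<..<u}"
          by (rule plus_emeasure[symmetric]) auto
        also have "emeasure ?D ({l<..<0} \<union> {0}) = emeasure ?D {l<..<0} + emeasure ?D {0}"
          by (rule plus_emeasure[symmetric]) auto
        also have "emeasure ?D {l<..<0} = ennreal (- l)"
          using neg[of "{0<..<-l}"] pos[of 0 "-l"] 3 by simp
        finally show ?thesis using 3 sing pos[of 0 u] by (simp flip: ennreal_plus)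
      qed
    qed
    then show "emeasure ?D (box l u) = ennreal (\<Prod>b\<in>Basis. (u - l) \<bullet> b)" by (simp add: box_real)
  qed simp
  then show ?thesis by simp
qed

lemma nn_integral_inverse:
  fixes f :: "real \<Rightarrow> ennreal"
  assumes [measurable]: "f \<in> borel_measurable borel"
  shows "(\<integral>\<^sup>+x. f (inverse x) \<partial>lborel) = (\<integral>\<^sup>+x. f x * ennreal (1 / x\<^sup>2) \<partial>lborel)"
proof -
  have "(\<integral>\<^sup>+x. f (inverse x) \<partial>lborel)
      = (\<integral>\<^sup>+x. f (inverse x) \<partial>distr (density lborel (\<lambda>x :: real. ennreal (1 / x\<^sup>2))) borel inverse)"
    by (simp add: distr_inverse_lborel)
  also have "\<dots> = (\<integral>\<^sup>+x. f x * ennreal (1 / x\<^sup>2) \<partial>lborel)"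
    by (subst nn_integral_distr, simp, simp, subst nn_integral_density)
       (auto intro!: nn_integral_cong simp: mult.commute)
  finally show ?thesis .
qed

text \<open>This is the measure on pairs of endpoints of hyperbolic geodesics, invariant under the
  diagonal action of Moebius maps. On the diagonal, a null set, the density is 0 by the convention 1
  / 0 = 0.\<close>

definition hyp :: "(real \<times> real) measure" where
  "hyp = density lborel (\<lambda>(x, y). ennreal (1 / (x - y)\<^sup>2))"

lemma sets_hyp [simp, measurable_cong]: "sets hyp = sets borel" and space_hyp [simp]: "space hyp = UNIV"
  by (simp_all add: hyp_def)

lemma emeasure_hyp:
  assumes "A \<in> sets borel"
  shows "emeasure hyp A =
    (\<integral>\<^sup>+x. \<integral>\<^sup>+y. ennreal (1 / (x - y)\<^sup>2) * indicator A (x, y) \<partial>lborel \<partial>lborel)"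
proof -
  have A[measurable]: "A \<in> sets (borel \<Otimes>\<^sub>M borel)" using assms by (simp only: borel_prod)
  have "emeasure hyp A = (\<integral>\<^sup>+z. (case z of (x, y) \<Rightarrow> ennreal (1 / (x - y)\<^sup>2)) * indicator A z \<partial>(lborel \<Otimes>\<^sub>M lborel))"
    unfolding hyp_def lborel_prod using assms
    by (subst emeasure_density) (auto simp: borel_prod[symmetric])
  also have "\<dots> = (\<integral>\<^sup>+x. \<integral>\<^sup>+y. (case (x, y) of (x, y) \<Rightarrow> ennreal (1 / (x - y)\<^sup>2)) * indicator A (x, y) \<partial>lborel \<partial>lborel)"
    by (subst lborel.nn_integral_fst[symmetric]) auto
  finally show ?thesis by simp
qed

text \<open>Preimages are taken in the whole plane: with \<open>inverse 0 = 0\<close> the maps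
  involved are total, so compositions need no domain conditions.\<close>

definition hyp_preserving :: "(real \<times> real \<Rightarrow> real \<times> real) \<Rightarrow> bool" where
  "hyp_preserving f \<longleftrightarrow> f \<in> borel_measurable borel \<and>
     (\<forall>A\<in>sets borel. emeasure hyp (f -` A) = emeasure hyp A)"

lemma hyp_preserving_comp:
  assumes f: "hyp_preserving f" and g: "hyp_preserving g"
  shows "hyp_preserving (\<lambda>v. f (g v))"
  unfolding hyp_preserving_def
proof (intro conjI ballI)
  have fm: "f \<in> borel_measurable borel" and gm: "g \<in> borel_measurable borel"
    using f g by (auto simp: hyp_preserving_def)
  show "(\<lambda>v. f (g v)) \<in> borel_measurable borel" by (rule measurable_compose[OF gm fm])
  fix A :: "(real \<times> real) set" assume A: "A \<in> sets borel"
  have "(\<lambda>v. f (g v)) -` A = g -` (f -` A)" by auto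
  then show "emeasure hyp ((\<lambda>v. f (g v)) -` A) = emeasure hyp A"
    using f g A measurable_sets_borel[OF fm A] by (simp add: hyp_preserving_def)
qed

text \<open>Here \<open>w\<close> is the density of the image of Lebesgue measure under
  \<open>s\<close>, and the left inverse \<open>s'\<close> rewrites the kernel at (x, y) as a
  function \<open>h\<close> of (s x, s y). The one-variable substitution \<open>int\<close> then
  applies to each coordinate in turn, and \<open>g\<close> says that the two Jacobians restore the
  kernel.\<close>

lemma hyp_preserving_diagonal:
  fixes s s' :: "real \<Rightarrow> real" and w :: "real \<Rightarrow> ennreal"
  assumes [measurable]: "s \<in> borel_measurable borel" "s' \<in> borel_measurable borel"
      "w \<in> borel_measurable borel"
    and inv: "\<And>x. s' (s x) = x"
    and int: "\<And>f. f \<in> borel_measurable borel \<Longrightarrow>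
      (\<integral>\<^sup>+x. f (s x) \<partial>lborel) = (\<integral>\<^sup>+x. f x * w x \<partial>lborel)"
    and g: "\<And>x y. x \<noteq> 0 \<Longrightarrow> y \<noteq> 0 \<Longrightarrow>
      ennreal (1 / (s' x - s' y)\<^sup>2) * w y * w x = ennreal (1 / (x - y)\<^sup>2)"
  shows "hyp_preserving (\<lambda>(x, y). (s x, s y))"
  unfolding hyp_preserving_def
proof (intro conjI ballI)
  show m: "(\<lambda>(x, y). (s x, s y)) \<in> borel_measurable borel"
    unfolding borel_prod[symmetric] by measurable
  fix A :: "(real \<times> real) set" assume A: "A \<in> sets borel"
  then have [measurable]: "A \<in> sets (borel \<Otimes>\<^sub>M borel)" by (simp only: borel_prod)
  define h where "h x y = ennreal (1 / (s' x - s' y)\<^sup>2) * indicator A (x, y)" for x y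
  have [measurable]: "case_prod h \<in> borel_measurable (borel \<Otimes>\<^sub>M borel)"
    unfolding h_def by measurable
  have "emeasure hyp ((\<lambda>(x, y). (s x, s y)) -` A) = (\<integral>\<^sup>+x. \<integral>\<^sup>+y. h (s x) (s y) \<partial>lborel \<partial>lborel)"
    using measurable_sets_borel[OF m A]
    by (subst emeasure_hyp) (auto simp: h_def inv intro!: nn_integral_cong split: split_indicator)
  also have "\<dots> = (\<integral>\<^sup>+x. \<integral>\<^sup>+y. h x (s y) \<partial>lborel * w x \<partial>lborel)"
    by (rule int) measurable
  also have "\<dots> = (\<integral>\<^sup>+x. \<integral>\<^sup>+y. h x y * w y \<partial>lborel * w x \<partial>lborel)"
    by (intro nn_integral_cong arg_cong2[where f = "(*)"] refl int) measurable
  also have "\<dots> = (\<integral>\<^sup>+x. \<integral>\<^sup>+y. h x y * w y * w x \<partial>lborel \<partial>lborel)"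
    by (intro nn_integral_cong nn_integral_multc[symmetric]) measurable
  also have "\<dots> = (\<integral>\<^sup>+x. \<integral>\<^sup>+y. ennreal (1 / (x - y)\<^sup>2) * indicator A (x, y) \<partial>lborel \<partial>lborel)"
  proof (rule nn_integral_cong_AE, use AE_lborel_singleton[of 0] in eventually_elim)
    case (elim x)
    show ?case
      by (rule nn_integral_cong_AE, use AE_lborel_singleton[of 0] in eventually_elim)
         (use elim g[of x] in \<open>auto simp: h_def split: split_indicator\<close>)
  qed
  finally show "emeasure hyp ((\<lambda>(x, y). (s x, s y)) -` A) = emeasure hyp A"
    using emeasure_hyp[OF A] by simp
qed

section \<open>Generators of the diagonal Moebius action\<close>

definition inv2 :: "real \<times> real \<Rightarrow> real \<times> real" where "inv2 = (\<lambda>(x, y). (inverse x, inverse y))"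
definition neg2 :: "real \<times> real \<Rightarrow> real \<times> real" where "neg2 = (\<lambda>(x, y). (- x, - y))"
definition add2 :: "real \<Rightarrow> real \<times> real \<Rightarrow> real \<times> real" where "add2 c = (\<lambda>(x, y). (x + c, y + c))"

text \<open>From 1 / x - 1 / y = (y - x) / (x y): the squared factor x y cancels the two
  Jacobians.\<close>

lemma hyp_preserving_inv2: "hyp_preserving inv2"
  unfolding inv2_def
proof (rule hyp_preserving_diagonal[where s' = inverse and w = "\<lambda>x. ennreal (1 / x\<^sup>2)"])
  show "ennreal (1 / (inverse x - inverse y)\<^sup>2) * ennreal (1 / y\<^sup>2) * ennreal (1 / x\<^sup>2) = ennreal (1 / (x - y)\<^sup>2)"
    if "x \<noteq> 0" "y \<noteq> 0" for x y :: real
  proof -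
    have "(1 / (inverse x - inverse y)\<^sup>2) * (1 / y\<^sup>2) * (1 / x\<^sup>2) = 1 / ((inverse x - inverse y) * x * y)\<^sup>2"
      by (simp add: power_mult_distrib)
    also have "(inverse x - inverse y) * x * y = y - x" using that by (simp add: field_simps)
    finally have "(1 / (inverse x - inverse y)\<^sup>2) * (1 / y\<^sup>2) * (1 / x\<^sup>2) = 1 / (x - y)\<^sup>2"
      by (simp add: power2_commute)
    then show ?thesis by (simp flip: ennreal_mult)
  qed
qed (auto intro: nn_integral_inverse)

lemma hyp_preserving_neg2: "hyp_preserving neg2"
  unfolding neg2_def
proof (rule hyp_preserving_diagonal[where s' = uminus and w = "\<lambda>x. 1"])
  show "(\<integral>\<^sup>+x. f (- x) \<partial>lborel) = (\<integral>\<^sup>+x. f x * 1 \<partial>lborel)"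
    if "f \<in> borel_measurable borel" for f :: "real \<Rightarrow> ennreal"
    using nn_integral_real_affine[OF that, of "-1" 0] by simp
qed (auto simp: power2_commute)

lemma hyp_preserving_add2: "hyp_preserving (add2 c)"
  unfolding add2_def
proof (rule hyp_preserving_diagonal[where s' = "\<lambda>x. x - c" and w = "\<lambda>x. 1"])
  show "(\<integral>\<^sup>+x. f (x + c) \<partial>lborel) = (\<integral>\<^sup>+x. f x * 1 \<partial>lborel)"
    if "f \<in> borel_measurable borel" for f :: "real \<Rightarrow> ennreal"
    using nn_integral_real_affine[OF that, of 1 c] by (simp add: add.commute)
qed auto

text \<open>The strip stays at distance a - c from the diagonal, and on it the kernel is at most 1 /
  (a - y)^2, which is integrable over y \<le> c.\<close>

lemma hyp_strip_finite:
  assumes "c < a"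
  shows "emeasure hyp ({a..b} \<times> {..c}) < \<infinity>"
proof -
  have "emeasure hyp ({a..b} \<times> {..c})
      = (\<integral>\<^sup>+x. \<integral>\<^sup>+y. ennreal (1 / (x - y)\<^sup>2) * indicator ({a..b} \<times> {..c}) (x, y) \<partial>lborel \<partial>lborel)"
    by (rule emeasure_hyp) (auto intro: borel_closed closed_Times)
  also have "\<dots> \<le> (\<integral>\<^sup>+x. \<integral>\<^sup>+y. (ennreal (1 / (a - y)\<^sup>2) * indicator {..c} y) * indicator {a..b} x \<partial>lborel \<partial>lborel)"
    using assms by (intro nn_integral_mono)
      (auto simp: indicator_def intro!: ennreal_leI divide_left_mono power_mono mult_pos_pos zero_less_power)
  also have "\<dots> = (\<integral>\<^sup>+x. ennreal (1 / (a - c)) * indicator {a..b} x \<partial>lborel)"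
    by (subst nn_integral_multc) (auto simp: nn_integral_inverse_square_tail[OF assms])
  also have "\<dots> = ennreal (1 / (a - c)) * emeasure lborel {a..b}"
    by (rule nn_integral_cmult_indicator) simp
  also have "\<dots> < \<infinity>" by (auto simp: emeasure_lborel_Icc_eq ennreal_mult_less_top)
  finally show ?thesis .
qed

lemma null_sets_hypI:
  assumes "A \<in> null_sets lborel"
  shows "A \<in> null_sets hyp"
proof -
  have m: "(\<lambda>(x, y). ennreal (1 / (x - y)\<^sup>2)) \<in> borel_measurable (lborel :: (real \<times> real) measure)"
    unfolding lborel_prod[symmetric] by measurable
  show ?thesis
    unfolding hyp_def using assms
    by (subst null_sets_density_iff[OF m]) (auto dest: AE_not_in elim: eventually_mono)
qed

lemma null_sets_hyp_countable:
  fixes K :: "real set"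
  assumes "countable K"
  shows "{(x, y). x \<in> K \<or> y \<in> K} \<in> null_sets hyp"
proof -
  have K: "K \<in> null_sets lborel" using assms by (rule countable_imp_null_set_lborel)
  then have [measurable]: "K \<in> sets borel" by auto
  have eq: "{(x, y). x \<in> K \<or> y \<in> K} = K \<times> UNIV \<union> UNIV \<times> K" by auto
  have "K \<times> UNIV \<union> UNIV \<times> K \<in> null_sets (lborel \<Otimes>\<^sub>M lborel)"
    using K by (intro null_sets.Un) (auto simp: lborel_prod null_sets_def lborel.emeasure_pair_measure_Times
       borel_prod[symmetric] simp flip: lborel_prod)
  then show ?thesis unfolding eq lborel_prod by (rule null_sets_hypI)
qed

lemma null_sets_hyp_vimage:
  "hyp_preserving f \<Longrightarrow> N \<in> null_sets hyp \<Longrightarrow> f -` N \<in> null_sets hyp"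
  by (auto simp: hyp_preserving_def null_sets_def measurable_sets_borel)

section \<open>The domain of the continued fraction map\<close>

definition cf_orbits :: "real \<Rightarrow> (real \<times> real) set" where
  "cf_orbits \<alpha> = {(cf_hat \<alpha> ^^ n) (x, 0) | x n.
     \<alpha> - 1 \<le> x \<and> x < \<alpha> \<and> (\<forall>i<n. fst ((cf_hat \<alpha> ^^ i) (x, 0)) \<noteq> 0)}"

lemma Omega_eq_closure: "Omega \<alpha> = closure (cf_orbits \<alpha>)"
  by (simp add: Omega_def cf_orbits_def)

lemma cf_orbits_step:
  assumes "q \<in> cf_orbits \<alpha>" "fst q \<noteq> 0"
  shows "cf_hat \<alpha> q \<in> cf_orbits \<alpha>"
proof -
  obtain x n where q: "q = (cf_hat \<alpha> ^^ n) (x, 0)" and x: "\<alpha> - 1 \<le> x" "x < \<alpha>"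
    and nz: "\<forall>i<n. fst ((cf_hat \<alpha> ^^ i) (x, 0)) \<noteq> 0"
    using assms(1) by (auto simp: cf_orbits_def)
  have "cf_hat \<alpha> q = (cf_hat \<alpha> ^^ Suc n) (x, 0)" using q by simp
  moreover have "\<forall>i<Suc n. fst ((cf_hat \<alpha> ^^ i) (x, 0)) \<noteq> 0"
    using nz assms(2) q by (auto simp: less_Suc_eq)
  ultimately show ?thesis using x unfolding cf_orbits_def by blast
qed

lemma cf_orbits_cases:
  assumes "p \<in> cf_orbits \<alpha>"
  obtains (base) x where "\<alpha> - 1 \<le> x" "x < \<alpha>" "p = (x, 0)"
    | (step) q where "q \<in> cf_orbits \<alpha>" "fst q \<noteq> 0" "p = cf_hat \<alpha> q"
proof -
  obtain x n where p: "p = (cf_hat \<alpha> ^^ n) (x, 0)" and x: "\<alpha> - 1 \<le> x" "x < \<alpha>"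
    and nz: "\<forall>i<n. fst ((cf_hat \<alpha> ^^ i) (x, 0)) \<noteq> 0"
    using assms by (auto simp: cf_orbits_def)
  show ?thesis
  proof (cases n)
    case 0 then show ?thesis using base p x by simp
  next
    case (Suc m)
    have "\<forall>i<m. fst ((cf_hat \<alpha> ^^ i) (x, 0)) \<noteq> 0" using nz Suc by auto
    then have "(cf_hat \<alpha> ^^ m) (x, 0) \<in> cf_orbits \<alpha>"
      unfolding cf_orbits_def using x by blast
    then show ?thesis using step[of "(cf_hat \<alpha> ^^ m) (x, 0)"] p nz Suc by auto
  qed
qed

lemma cf_orbits_induct [consumes 1, case_names base step]:
  assumes "p \<in> cf_orbits \<alpha>"
    and base: "\<And>x. \<alpha> - 1 \<le> x \<Longrightarrow> x < \<alpha> \<Longrightarrow> P (x, 0)"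
    and step: "\<And>q. q \<in> cf_orbits \<alpha> \<Longrightarrow> fst q \<noteq> 0 \<Longrightarrow> P q \<Longrightarrow> P (cf_hat \<alpha> q)"
  shows "P p"
proof -
  obtain x n where p: "p = (cf_hat \<alpha> ^^ n) (x, 0)" and x: "\<alpha> - 1 \<le> x" "x < \<alpha>"
    and nz: "\<forall>i<n. fst ((cf_hat \<alpha> ^^ i) (x, 0)) \<noteq> 0"
    using assms by (auto simp: cf_orbits_def)
  have "P ((cf_hat \<alpha> ^^ m) (x, 0))" if "m \<le> n" for m
    using that
  proof (induction m)
    case 0 then show ?case using base x by simp
  next
    case (Suc m)
    have "\<forall>i<m. fst ((cf_hat \<alpha> ^^ i) (x, 0)) \<noteq> 0" using nz Suc by auto
    then have "(cf_hat \<alpha> ^^ m) (x, 0) \<in> cf_orbits \<alpha>"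
      unfolding cf_orbits_def using x by blast
    then show ?case using step[of "(cf_hat \<alpha> ^^ m) (x, 0)"] nz Suc by simp
  qed
  then show ?thesis using p by simp
qed

section \<open>One step of the continued fraction map, forwards and backwards, on the closed
  domain\<close>

context
  fixes \<alpha> :: real
  assumes \<alpha>: "0 < \<alpha>" "\<alpha> < 1 / 2"
begin

lemma cf_digit_eqI:
  assumes "\<alpha> - 1 \<le> 1 / \<bar>x\<bar> - real b" "1 / \<bar>x\<bar> - real b < \<alpha>"
  shows "cf_digit \<alpha> x = int b"
  unfolding cf_digit_def using assms by (intro floor_unique) auto

text \<open>Since \<alpha> < 1 / 2, both ends of the interval satisfy |x| \<le> 1 - \<alpha>, and 1
  / (1 - \<alpha>) \<ge> 1 + \<alpha>.\<close>

lemma cf_digit_ge_2: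
  assumes "\<alpha> - 1 \<le> x" "x < \<alpha>" "x \<noteq> 0"
  shows "2 \<le> cf_digit \<alpha> x"
proof -
  have "\<bar>x\<bar> \<le> 1 - \<alpha>" using assms \<alpha> by auto
  then have "1 / (1 - \<alpha>) \<le> 1 / \<bar>x\<bar>" using assms \<alpha> by (intro divide_left_mono) auto
  moreover have "1 + \<alpha> \<le> 1 / (1 - \<alpha>)" using \<alpha> by (simp add: field_simps)
  ultimately show ?thesis unfolding cf_digit_def by linarith
qed

text \<open>Treats both signs at once: \<open>e\<close> is the sign of \<open>x\<close>, so e / x =
  1 / |x|. The pair (e, b) labels the branches of the continued fraction map from here on.\<close>

lemma cf_hat_cases:
  assumes "\<alpha> - 1 \<le> x" "x < \<alpha>" "x \<noteq> 0"
  obtains e :: real and b :: nat where "e \<in> {1, -1}" "0 < e * x" "2 \<le> b"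
    "\<alpha> - 1 \<le> e / x - b" "e / x - b < \<alpha>"
    "\<And>t. cf_hat \<alpha> (x, t) = (e / x - b, 1 / (b + e * t))"
proof -
  define b where "b = nat (cf_digit \<alpha> x)"
  have b: "2 \<le> b" "real_of_int (cf_digit \<alpha> x) = real b"
    using cf_digit_ge_2[OF assms] by (auto simp: b_def)
  have r: "\<alpha> - 1 \<le> 1 / \<bar>x\<bar> - real b" "1 / \<bar>x\<bar> - real b < \<alpha>"
    using b(2) unfolding cf_digit_def by linarith+
  show thesis
  proof (cases "x < 0")
    case True
    show ?thesis by (rule that[of "-1" b]) (use True b r in \<open>auto simp: cf_hat_def Let_def\<close>)
  next
    case False
    show ?thesis by (rule that[of 1 b]) (use False assms b r in \<open>auto simp: cf_hat_def Let_def\<close>)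
  qed
qed

lemma cf_orbits_bounds:
  assumes "p \<in> cf_orbits \<alpha>"
  shows "\<alpha> - 1 \<le> fst p \<and> fst p < \<alpha> \<and> 0 \<le> snd p \<and> snd p \<le> 1"
  using assms
proof (induction rule: cf_orbits_induct)
  case (base x) then show ?case by simp
next
  case (step q)
  obtain x t where q: "q = (x, t)" by (cases q)
  obtain e :: real and b :: nat where e: "e \<in> {1, -1}" "2 \<le> b"
    "\<alpha> - 1 \<le> e / x - b" "e / x - b < \<alpha>"
    "\<And>t. cf_hat \<alpha> (x, t) = (e / x - b, 1 / (b + e * t))"
    using cf_hat_cases[of x] step.hyps(2) step.IH unfolding q fst_conv snd_conv by metis
  have "1 \<le> b + e * t" using e step q by auto
  then show ?case using e by (auto simp: q)
qed

lemma Omega_bounds: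
  assumes "(x, t) \<in> Omega \<alpha>"
  shows "\<alpha> - 1 \<le> x" "x \<le> \<alpha>" "0 \<le> t" "t \<le> 1"
proof -
  have "Omega \<alpha> \<subseteq> {\<alpha> - 1..\<alpha>} \<times> {0..1}"
    unfolding Omega_eq_closure using cf_orbits_bounds
    by (intro closure_minimal closed_Times) (auto simp: less_imp_le mem_Times_iff)
  then show "\<alpha> - 1 \<le> x" "x \<le> \<alpha>" "0 \<le> t" "t \<le> 1" using assms by auto
qed

text \<open>On the open set \<open>U\<close>, where sign and digit are constant, the map is a single
  Moebius branch \<open>f\<close>, so membership passes from orbit points to their limits by
  continuity. Strict inequalities at both ends of the interval keep the limit point itself inside
  \<open>U\<close>.\<close>

lemma Omega_forward:
  assumes p: "(x, t) \<in> Omega \<alpha>" and e: "e \<in> {1, -1}" "0 < e * x"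
    and b: "\<alpha> - 1 < e / x - real b" "e / x - real b < \<alpha>"
  shows "(e / x - real b, 1 / (real b + e * t)) \<in> Omega \<alpha>"
proof -
  define U where "U = {q :: real \<times> real. 0 < e * fst q \<and> \<alpha> - 1 < e / fst q - real b \<and> e / fst q - real b < \<alpha>}"
  have "open {z :: real. 0 < e * z \<and> \<alpha> - 1 < e / z - real b \<and> e / z - real b < \<alpha>}" (is "open ?Z")
  proof -
    have o: "open {z :: real. 0 < e * z}" by (intro open_Collect_less continuous_intros)
    have "continuous_on {z :: real. 0 < e * z} (\<lambda>z. e / z - real b)"
      by (intro continuous_intros) auto
    moreover have "?Z = {z. 0 < e * z} \<inter> (\<lambda>z. e / z - real b) -` {\<alpha> - 1<..<\<alpha>}" by auto
    ultimately show ?thesis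
      using continuous_open_preimage[OF _ o open_greaterThanLessThan[of "\<alpha> - 1" \<alpha>]] by simp
  qed
  then have "open (fst -` ?Z :: (real \<times> real) set)" by (rule open_vimage_fst)
  also have "fst -` ?Z = U" by (auto simp: U_def)
  finally have U: "open U" .
  define f where "f q = (e / fst q - real b, 1 / (real b + e * snd q))" for q :: "real \<times> real"
  have f: "f q \<in> cf_orbits \<alpha>" if "q \<in> U \<inter> cf_orbits \<alpha>" for q
  proof -
    obtain z s where q: "q = (z, s)" by (cases q)
    have z: "z \<noteq> 0" "e / z = 1 / \<bar>z\<bar>" using that e(1) by (auto simp: U_def q zero_less_mult_iff)
    have "cf_digit \<alpha> z = int b" using that z by (intro cf_digit_eqI) (auto simp: U_def q)
    then have "cf_hat \<alpha> q = f q" using that e(1) by (auto simp: U_def q f_def cf_hat_def Let_def)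
    then show ?thesis using cf_orbits_step[of q \<alpha>] that z q by auto
  qed
  \<comment> \<open>Continuity of \<open>f\<close> at the limit point needs a nonzero denominator: b
    \<ge> 2 and t \<le> 1 give b + e t \<ge> 1.\<close>
  have b2: "2 \<le> b"
  proof (rule ccontr)
    assume "\<not> 2 \<le> b"
    then have "real b \<le> 1" by simp
    have "e / x = 1 / \<bar>x\<bar>" using e by (auto simp: zero_less_mult_iff)
    moreover have "0 < \<bar>x\<bar>" "\<bar>x\<bar> \<le> 1 - \<alpha>" using Omega_bounds[OF p] \<alpha> e by auto
    then have "1 / (1 - \<alpha>) \<le> 1 / \<bar>x\<bar>" using \<alpha> by (intro divide_left_mono) auto
    moreover have "1 + \<alpha> \<le> 1 / (1 - \<alpha>)" using \<alpha> by (simp add: field_simps)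
    ultimately show False using b \<open>real b \<le> 1\<close> by linarith
  qed
  have "(x, t) \<in> closure (U \<inter> cf_orbits \<alpha>)"
    using open_Int_closure_subset[OF U, of "cf_orbits \<alpha>"] p e b
    by (auto simp: Omega_eq_closure U_def)
  then obtain s where s: "\<And>n. s n \<in> U \<inter> cf_orbits \<alpha>" "s \<longlonglongrightarrow> (x, t)"
    unfolding closure_sequential by blast
  have "x \<noteq> 0" "real b + e * t \<noteq> 0" using e b2 Omega_bounds[OF p] by auto
  then have "isCont f (x, t)" unfolding f_def by (intro continuous_intros) auto
  then have "(\<lambda>n. f (s n)) \<longlonglongrightarrow> f (x, t)" by (rule isCont_tendsto_compose[OF _ s(2)])
  moreover have "f (s n) \<in> cf_orbits \<alpha>" for n using f s(1) by blast
  ultimately have "f (x, t) \<in> closure (cf_orbits \<alpha>)"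
    unfolding closure_sequential by (intro exI[of _ "\<lambda>n. f (s n)"]) auto
  then show ?thesis by (simp add: f_def Omega_eq_closure)
qed

text \<open>Positive second coordinate bounds the digit that produced it, so only finitely many inverse
  branches are involved and passing to the closure creates no new points.\<close>

lemma Omega_backward:
  fixes x t :: real
  assumes p: "(x, t) \<in> Omega \<alpha>" and t: "0 < t"
  obtains e :: real and b :: nat where "e \<in> {1, -1}" "2 \<le> b"
    "(e / (b + x), e * (1 / t - b)) \<in> Omega \<alpha>"
proof -
  define S where "S = {\<alpha> - 1..\<alpha>} \<times> {t / 2..}"
  define g where "g e b q = (e / (real b + fst q), e * (1 / snd q - real b))" for e b and q :: "real \<times> real"
  \<comment> \<open>An orbit point with second coordinate 1 / (b + e s) > t / 2 and 0 \<le> s \<le>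
    1 has b < 2 / t + 1. Halving t makes this an open condition that holds around the given
    point.\<close>
  define B where "B = nat \<lceil>2 / t\<rceil> + 1"
  define I where "I = {1, -1 :: real} \<times> {2..B}"
  define L where "L e b = {q \<in> S. g e b q \<in> Omega \<alpha>}" for e b
  have "closed (L e b)" if "2 \<le> b" for e b
  proof -
    have "continuous_on S (g e b)"
      unfolding g_def S_def using that t \<alpha>
      by (intro continuous_intros) auto
    moreover have "closed S" unfolding S_def by (intro closed_Times) auto
    moreover have "L e b = S \<inter> g e b -` Omega \<alpha>" by (auto simp: L_def)
    ultimately show ?thesis
      using continuous_closed_preimage[of S "g e b" "Omega \<alpha>"] by (simp add: Omega_eq_closure)
  qed
  then have cl: "closed (\<Union>(e, b)\<in>I. L e b)"
    by (intro closed_UN) (auto simp: I_def)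
  have "{q. t / 2 < snd q} \<inter> cf_orbits \<alpha> \<subseteq> (\<Union>(e, b)\<in>I. L e b)"
  proof
    fix r assume r: "r \<in> {q. t / 2 < snd q} \<inter> cf_orbits \<alpha>"
    then have rE: "r \<in> cf_orbits \<alpha>" by simp
    from rE show "r \<in> (\<Union>(e, b)\<in>I. L e b)"
    proof (cases rule: cf_orbits_cases)
      case (base y) then show ?thesis using r t by simp
    next
      case (step q)
      obtain y s where q: "q = (y, s)" by (cases q)
      have qb: "\<alpha> - 1 \<le> y" "y < \<alpha>" "0 \<le> s" "s \<le> 1" "y \<noteq> 0"
        using cf_orbits_bounds[OF step(1)] step q by auto
      obtain e :: real and b :: nat where e: "e \<in> {1, -1}" "0 < e * y" "2 \<le> b"
        "\<alpha> - 1 \<le> e / y - b" "e / y - b < \<alpha>"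
        "cf_hat \<alpha> (y, s) = (e / y - b, 1 / (b + e * s))"
        using cf_hat_cases[of y] qb by metis
      have r': "r = (e / y - b, 1 / (b + e * s))" using step q e by simp
      have pos: "1 \<le> b + e * s" using e qb by auto
      have "t / 2 < 1 / (b + e * s)" using r r' by simp
      then have "t / 2 * (b + e * s) < 1" using pos by (simp add: field_simps)
      then have "b + e * s < 2 / t" using t by (simp add: field_simps)
      then have "b < 2 / t + 1" using e qb by auto
      then have "b \<le> B" unfolding B_def by linarith
      moreover have "g e b r = q" using e qb pos unfolding g_def r' q by auto
      moreover have "r \<in> S" using r r' e by (simp add: S_def)
      ultimately have "r \<in> L e b" "(e, b) \<in> I"
        using step(1) closure_subset[of "cf_orbits \<alpha>"] e by (auto simp: L_def Omega_eq_closure I_def)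
      then show ?thesis by blast
    qed
  qed
  then have "closure ({q. t / 2 < snd q} \<inter> cf_orbits \<alpha>) \<subseteq> (\<Union>(e, b)\<in>I. L e b)"
    using cl by (rule closure_minimal)
  moreover have "open {q :: real \<times> real. t / 2 < snd q}"
    by (intro open_Collect_less continuous_intros)
  ultimately have "{q. t / 2 < snd q} \<inter> Omega \<alpha> \<subseteq> (\<Union>(e, b)\<in>I. L e b)"
    unfolding Omega_eq_closure using open_Int_closure_subset by blast
  moreover have "(x, t) \<in> {q. t / 2 < snd q} \<inter> Omega \<alpha>" using p t by auto
  ultimately obtain e b where "(e, b) \<in> I" "(x, t) \<in> L e b" by blast
  then show thesis using that[of e b] by (auto simp: L_def I_def g_def)
qed

end

section \<open>The planar map on generic points\<close>

text \<open>A countable set containing \<open>\<alpha>\<close> and the integers and closed under all the maps involved. Off this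
  set no point is ever sent to \<open>\<infinity>\<close> or to an endpoint of an interval.\<close>

definition mobius_pts :: "real \<Rightarrow> real set" where
  "mobius_pts \<alpha> = range (\<lambda>(a, b, c, d). (of_int a + of_int b * \<alpha>) / (of_int c + of_int d * \<alpha>))"

lemma countable_mobius_pts: "countable (mobius_pts \<alpha>)"
  by (simp add: mobius_pts_def)

lemma mobius_ptsI: "x = (of_int a + of_int b * \<alpha>) / (of_int c + of_int d * \<alpha>) \<Longrightarrow> x \<in> mobius_pts \<alpha>"
  unfolding mobius_pts_def by (rule range_eqI[where x = "(a, b, c, d)"]) simp

lemma mobius_ptsE:
  assumes "x \<in> mobius_pts \<alpha>"
  obtains a b c d where "x = (of_int a + of_int b * \<alpha>) / (of_int c + of_int d * \<alpha>)"
  using assms by (auto simp: mobius_pts_def)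

lemma mobius_pts_const [simp]: "of_int n \<in> mobius_pts \<alpha>" "\<alpha> \<in> mobius_pts \<alpha>"
  using mobius_ptsI[of "of_int n" n 0 \<alpha> 1 0] mobius_ptsI[of \<alpha> 0 1 \<alpha> 1 0] by auto

lemma mobius_pts_consts [simp]:
  "0 \<in> mobius_pts \<alpha>" "1 \<in> mobius_pts \<alpha>" "numeral k \<in> mobius_pts \<alpha>" "real n \<in> mobius_pts \<alpha>"
  using mobius_pts_const(1)[of 0 \<alpha>] mobius_pts_const(1)[of 1 \<alpha>]
    mobius_pts_const(1)[of "numeral k" \<alpha>] mobius_pts_const(1)[of "int n" \<alpha>] by auto

lemma mobius_pts_uminus [simp]: "- x \<in> mobius_pts \<alpha> \<longleftrightarrow> x \<in> mobius_pts \<alpha>"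
proof -
  have "- x \<in> mobius_pts \<alpha>" if m: "x \<in> mobius_pts \<alpha>" for x
  proof -
    obtain a b c d where "x = (of_int a + of_int b * \<alpha>) / (of_int c + of_int d * \<alpha>)"
      using m by (rule mobius_ptsE)
    then show ?thesis
      by (intro mobius_ptsI[of _ "- a" "- b" _ c d]) (simp add: minus_divide_left)
  qed
  from this[of x] this[of "- x"] show ?thesis by auto
qed

lemma mobius_pts_inverse [simp]: "inverse x \<in> mobius_pts \<alpha> \<longleftrightarrow> x \<in> mobius_pts \<alpha>"
proof -
  have "inverse x \<in> mobius_pts \<alpha>" if m: "x \<in> mobius_pts \<alpha>" for x
  proof -
    obtain a b c d where "x = (of_int a + of_int b * \<alpha>) / (of_int c + of_int d * \<alpha>)"
      using m by (rule mobius_ptsE)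
    then show ?thesis by (intro mobius_ptsI[of _ c d _ a b]) (simp add: inverse_divide)
  qed
  from this[of x] this[of "inverse x"] show ?thesis by auto
qed

lemma mobius_pts_add_int [simp]: "x + of_int n \<in> mobius_pts \<alpha> \<longleftrightarrow> x \<in> mobius_pts \<alpha>"
proof -
  have "x + of_int n \<in> mobius_pts \<alpha>" if m: "x \<in> mobius_pts \<alpha>" for x n
  proof -
    obtain a b c d where x: "x = (of_int a + of_int b * \<alpha>) / (of_int c + of_int d * \<alpha>)"
      using m by (rule mobius_ptsE)
    show ?thesis
    proof (cases "of_int c + of_int d * \<alpha> = 0")
      \<comment> \<open>A vanishing denominator means x = 0, by the division convention.\<close>
      case True then show ?thesis by (simp add: x)
    next
      case False
      then show ?thesis
        by (intro mobius_ptsI[of _ "a + n * c" "b + n * d" _ c d]) (simp add: x field_simps)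
    qed
  qed
  from this[of x n] this[of "x + of_int n" "- n"] show ?thesis by auto
qed

lemma mobius_pts_shift [simp]:
  "x + real n \<in> mobius_pts \<alpha> \<longleftrightarrow> x \<in> mobius_pts \<alpha>" "real n + x \<in> mobius_pts \<alpha> \<longleftrightarrow> x \<in> mobius_pts \<alpha>"
  "x - real n \<in> mobius_pts \<alpha> \<longleftrightarrow> x \<in> mobius_pts \<alpha>"
  "x + 1 \<in> mobius_pts \<alpha> \<longleftrightarrow> x \<in> mobius_pts \<alpha>" "1 + x \<in> mobius_pts \<alpha> \<longleftrightarrow> x \<in> mobius_pts \<alpha>"
  "x - 1 \<in> mobius_pts \<alpha> \<longleftrightarrow> x \<in> mobius_pts \<alpha>"
  using mobius_pts_add_int[of x "int n" \<alpha>] mobius_pts_add_int[of x "- int n" \<alpha>]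
    mobius_pts_add_int[of x 1 \<alpha>] mobius_pts_add_int[of x "- 1" \<alpha>] by (auto simp: add.commute)

lemma mobius_pts_sign [simp]:
  "e \<in> {1, -1} \<Longrightarrow> e * x \<in> mobius_pts \<alpha> \<longleftrightarrow> x \<in> mobius_pts \<alpha>" by auto

definition generic :: "real \<Rightarrow> (real \<times> real) set" where
  "generic \<alpha> = {(x, y). x \<notin> mobius_pts \<alpha> \<and> y \<notin> mobius_pts \<alpha>}"

lemma null_sets_not_generic: "- generic \<alpha> \<in> null_sets hyp"
proof -
  have "- generic \<alpha> = {(x, y). x \<in> mobius_pts \<alpha> \<or> y \<in> mobius_pts \<alpha>}" by (auto simp: generic_def)
  then show ?thesis using null_sets_hyp_countable[OF countable_mobius_pts] by simp
qed

text \<open>The part of \<open>Omega_star\<close> with finite second coordinate, in plain reals. The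
  omitted line y = -\<infinity> corresponds to t = 0 in \<open>Omega\<close> and is null.\<close>

definition Omega_fin :: "real \<Rightarrow> (real \<times> real) set" where
  "Omega_fin \<alpha> = {(x, y). y < 0 \<and> (x, - 1 / y) \<in> Omega \<alpha>}"

definition core :: "real \<Rightarrow> (real \<times> real) set" where
  "core \<alpha> = Omega_fin \<alpha> \<inter> generic \<alpha>"

text \<open>In the coordinates \<open>(1 / x, 1 / y)\<close> the Farey map is \<open>(u, w) \<mapsto> (u - 1, w - 1)\<close> until
  \<open>u\<close> leaves \<open>(\<alpha>, \<infinity>)\<close>, so \<open>tower\<close> is the generic part of \<open>(\<Upsilon>\<^sub>\<alpha>)\<^sup>-\<^sup>1\<close> with \<open>i = k - j\<close>.\<close>

definition tower :: "real \<Rightarrow> (real \<times> real) set" where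
  "tower \<alpha> = {(x, y) \<in> generic \<alpha>. \<alpha> < inverse x \<and> (\<exists>i :: nat. \<exists>e\<in>{1, -1}. 1 \<le> i \<and>
     (e * inverse (inverse x + real i), e * inverse (inverse y + real i)) \<in> core \<alpha>)}"

text \<open>The three formulas of the planar map (negative, small positive, large x), spelled as
  words in the generators so that invariance of \<open>hyp\<close> is inherited. Every index other
  than 1 and 2 means the third branch.\<close>

definition branch :: "nat \<Rightarrow> real \<times> real \<Rightarrow> real \<times> real" where
  "branch i v = (if i = 1 then inv2 (add2 (- 1) (inv2 (neg2 v)))
     else if i = 2 then inv2 (add2 (- 1) (inv2 v)) else add2 (- 1) (inv2 v))"

definition branch_inv :: "nat \<Rightarrow> real \<times> real \<Rightarrow> real \<times> real" where
  "branch_inv i v = (if i = 1 then neg2 (inv2 (add2 1 (inv2 v)))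
     else if i = 2 then inv2 (add2 1 (inv2 v)) else inv2 (add2 1 v))"

text \<open>Holds without exception because of \<open>inverse 0 = 0\<close>.\<close>

lemma branch_branch_inv [simp]: "branch i (branch_inv i v) = v" "branch_inv i (branch i v) = v"
  by (auto simp: branch_def branch_inv_def inv2_def add2_def neg2_def split: prod.splits)

definition forward_index :: "real \<Rightarrow> real \<Rightarrow> nat" where
  "forward_index \<alpha> x = (if x < 0 then 1 else if x < 1 / (1 + \<alpha>) then 2 else 3)"

text \<open>Guesses from an image point which branch produced it. The order of the tests matters:
  points of \<open>Omega_fin\<close> have y \<le> -1 as well, and are always attributed to the third
  branch.\<close>

definition backward_index :: "real \<Rightarrow> real \<times> real \<Rightarrow> nat" where
  "backward_index \<alpha> v = (if v \<in> Omega_fin \<alpha> then 3 else if snd v < - 1 then 1 else 2)"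

definition farey_fin :: "real \<Rightarrow> real \<times> real \<Rightarrow> real \<times> real" where
  "farey_fin \<alpha> v = branch (forward_index \<alpha> (fst v)) v"

definition farey_inv :: "real \<Rightarrow> real \<times> real \<Rightarrow> real \<times> real" where
  "farey_inv \<alpha> v = branch_inv (backward_index \<alpha> v) v"

section \<open>The planar map and its inverse on \<open>core\<close> and
  \<open>tower\<close>\<close>

context
  fixes \<alpha> :: real
  assumes \<alpha>: "0 < \<alpha>" "\<alpha> < 1 / 2"
begin

lemma core_bounds:
  assumes "(x, y) \<in> core \<alpha>"
  shows "\<alpha> - 1 < x" "x < \<alpha>" "y < - 1" "x \<notin> mobius_pts \<alpha>" "y \<notin> mobius_pts \<alpha>"
proof -
  have O: "(x, - 1 / y) \<in> Omega \<alpha>" "y < 0"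
    and g: "x \<notin> mobius_pts \<alpha>" "y \<notin> mobius_pts \<alpha>"
    using assms by (auto simp: core_def Omega_fin_def generic_def)
  show "x \<notin> mobius_pts \<alpha>" "y \<notin> mobius_pts \<alpha>" by fact+
  note b = Omega_bounds[OF \<alpha> O(1)]
  have "\<alpha> - 1 \<in> mobius_pts \<alpha>" by simp
  then have "x \<noteq> \<alpha> - 1" "x \<noteq> \<alpha>" using g by auto
  then show "\<alpha> - 1 < x" "x < \<alpha>" using b by auto
  have "- 1 \<in> mobius_pts \<alpha>" by simp
  then have "y \<noteq> - 1" using g by metis
  moreover have "y \<le> - 1" using b(4) O(2) by (simp add: field_simps)
  ultimately show "y < - 1" by simp
qed

text \<open>With y = - 1 / t the fibre action t \<mapsto> 1 / (b + e t) becomes y \<mapsto> e / y -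
  b, the same Moebius map as on the first coordinate. The image stays negative because |1 / y| < 1
  \<le> b.\<close>

lemma core_forward:
  assumes p: "(x, y) \<in> core \<alpha>" and e: "e \<in> {1, -1}" "0 < e * x"
    and b: "\<alpha> - 1 < e * inverse x - real b" "e * inverse x - real b < \<alpha>"
  shows "(e * inverse x - real b, e * inverse y - real b) \<in> core \<alpha>"
proof -
  note bd = core_bounds[OF p]
  have O: "(x, - 1 / y) \<in> Omega \<alpha>" using p by (simp add: core_def Omega_fin_def)
  have "0 < real b"
  proof (rule ccontr)
    assume "\<not> 0 < real b"
    then have b0: "b = 0" by simp
    have "\<bar>x\<bar> < 1" "x \<noteq> 0" using bd \<alpha> e by auto
    then have "1 < inverse \<bar>x\<bar>" by (simp add: one_less_inverse_iff)
    moreover have "e * inverse x = inverse \<bar>x\<bar>" using e by (auto simp: abs_if zero_less_mult_iff)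
    ultimately show False using b b0 \<alpha> by simp
  qed
  then have b1: "1 \<le> real b" by simp
  have "- 1 < e * inverse y" "e * inverse y < 1" using e bd by (auto simp: field_simps)
  then have neg: "e * inverse y - real b < 0" using b1 by simp
  have "(e / x - real b, 1 / (real b + e * (- 1 / y))) \<in> Omega \<alpha>"
    using b by (intro Omega_forward[OF \<alpha> O e]) (auto simp: divide_inverse)
  moreover have "1 / (real b + e * (- 1 / y)) = - 1 / (e * inverse y - real b)"
  proof -
    have "real b + e * (- 1 / y) = - (e * inverse y - real b)" by (simp add: divide_inverse)
    then show ?thesis by (metis div_minus1_right divide_divide_eq_left minus_divide_left minus_divide_right)
  qed
  ultimately have "(e * inverse x - real b, e * inverse y - real b) \<in> Omega_fin \<alpha>"
    using neg by (simp add: Omega_fin_def divide_inverse)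
  then show ?thesis using bd e(1) by (simp add: core_def generic_def)
qed

text \<open>A finite y means t > 0, as \<open>Omega_backward\<close> requires; genericity keeps the
  predecessor off b + y = 0, so its second coordinate is again finite and negative.\<close>

lemma core_backward:
  assumes p: "(x, y) \<in> core \<alpha>"
  obtains e :: real and b :: nat where "e \<in> {1, -1}" "2 \<le> b"
    "(e * inverse (real b + x), e * inverse (real b + y)) \<in> core \<alpha>"
proof -
  note bd = core_bounds[OF p]
  have O: "(x, - 1 / y) \<in> Omega \<alpha>" using p by (simp add: core_def Omega_fin_def)
  obtain e :: real and b :: nat where e: "e \<in> {1, -1}" and b: "2 \<le> b"
    and q: "(e / (b + x), e * (1 / (- 1 / y) - b)) \<in> Omega \<alpha>"
    using Omega_backward[OF \<alpha> O] bd by (auto simp: divide_neg_neg)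
  have t: "e * (1 / (- 1 / y) - b) = - (e * (b + y))" by (simp add: algebra_simps)
  have "real b + y \<noteq> 0" using bd(5) mobius_pts_shift(2)[of b y \<alpha>] by (metis mobius_pts_consts(1))
  then have "e * (b + y) \<noteq> 0" using e by auto
  then have "e * (b + y) < 0" using Omega_bounds(3)[OF \<alpha> q] t by linarith
  then have neg: "e * inverse (b + y) < 0" using e by auto
  have eq: "- 1 / (e * inverse (b + y)) = - (e * (b + y))" using e by (auto simp: divide_inverse)
  have "(e * inverse (real b + x), - 1 / (e * inverse (real b + y))) \<in> Omega \<alpha>"
    using q unfolding t eq divide_inverse[of e] .
  then have "(e * inverse (real b + x), e * inverse (real b + y)) \<in> core \<alpha>"
    using neg bd e by (simp add: core_def Omega_fin_def generic_def)
  then show thesis using that e b by blast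
qed

lemma towerE:
  assumes "(x, y) \<in> tower \<alpha>"
  obtains i :: nat and e :: real where "1 \<le> i" "e \<in> {1, -1}" "\<alpha> < inverse x"
    "(e * inverse (inverse x + real i), e * inverse (inverse y + real i)) \<in> core \<alpha>"
  using assms unfolding tower_def mem_Collect_eq prod.case by blast

text \<open>A second coordinate below -1 forces -1 < z < 0 if e = 1 and 0 < z < 1 if e = -1. Applied
  with z = 1 / y + i, this limits the floor i on which a point with given y can lie.\<close>

lemma core_second_less_1:
  assumes "(x, e * inverse z) \<in> core \<alpha>" "e \<in> {1, -1}"
  shows "z < 1" "0 < z \<Longrightarrow> e = - 1"
proof -
  have lt: "e * inverse z < - 1" using core_bounds(3)[OF assms(1)] .
  show "z < 1"
  proof (rule ccontr)
    assume "\<not> z < 1"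
    then have "0 < inverse z" "inverse z \<le> 1" by (auto simp: inverse_le_1_iff)
    moreover have "e * inverse z = inverse z \<or> e * inverse z = - inverse z" using assms(2) by auto
    ultimately show False using lt by linarith
  qed
  show "e = - 1" if "0 < z"
  proof (rule ccontr)
    assume "e \<noteq> - 1"
    then have "inverse z < - 1" using lt assms(2) by simp
    then show False using positive_imp_inverse_positive[OF that] by linarith
  qed
qed

lemma tower_neg:
  assumes "(x, y) \<in> tower \<alpha>"
  shows "y < 0"
proof -
  obtain i :: nat and e where i: "1 \<le> i" "e \<in> {1, -1}"
    "(e * inverse (inverse x + i), e * inverse (inverse y + i)) \<in> core \<alpha>"
    by (rule towerE[OF assms], rule that)
  have "inverse y + i < 1" using core_second_less_1(1)[OF i(3,2)] .
  then have "inverse y < 0" using i(1) by linarith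
  then show ?thesis by simp
qed

text \<open>The first branch lifts a base point with sign -1 to floor 1, the second lifts a base
  point with sign 1 to floor 1 or raises floor i to i + 1, and the third returns from floor i to the
  base as the continued fraction map with digit i + 1. Branch and guessed branch can differ only
  when the first branch lands in \<open>core\<close>.\<close>

lemma farey_fin_in:
  assumes v: "v \<in> core \<alpha> \<union> tower \<alpha>"
  shows "farey_fin \<alpha> v \<in> core \<alpha> \<union> tower \<alpha> \<and>
    (backward_index \<alpha> (farey_fin \<alpha> v) = forward_index \<alpha> (fst v) \<or>
     fst v < 0 \<and> v \<in> core \<alpha> \<and> farey_fin \<alpha> v \<in> core \<alpha>)"
proof -
  obtain x y where xy: "v = (x, y)" by (cases v)
  have g: "x \<notin> mobius_pts \<alpha>" "y \<notin> mobius_pts \<alpha>"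
    using v by (auto simp: xy core_def tower_def generic_def)
  have x0: "x \<noteq> 0" using g by auto
  have y0: "y < 0" using v core_bounds(3)[of x y] tower_neg[of x y] by (auto simp: xy)
  consider (1) "x < 0" | (2) "0 < x" "x < 1 / (1 + \<alpha>)" | (3) "1 / (1 + \<alpha>) \<le> x"
    using x0 by linarith
  then show ?thesis
  proof cases
    case 1
    then have "\<not> \<alpha> < inverse x" using \<alpha> negative_imp_inverse_negative[of x] by linarith
    then have c: "(x, y) \<in> core \<alpha>" using v by (simp add: xy tower_def)
    note bd = core_bounds[OF c]
    have T: "farey_fin \<alpha> v = (inverse (- inverse x - 1), inverse (- inverse y - 1))"
      using 1 by (simp add: farey_fin_def forward_index_def branch_def xy inv2_def add2_def neg2_def)
    have "- x < 1 - \<alpha>" using bd by simp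
    \<comment> \<open>The left end \<alpha> - 1 of the interval is just large enough for -1 / x - 1
      to exceed \<alpha>, the threshold in \<open>tower\<close>.\<close>
    then have "inverse (1 - \<alpha>) < inverse (- x)" using 1 \<alpha> by (intro less_imp_inverse_less) auto
    moreover have "1 + \<alpha> \<le> inverse (1 - \<alpha>)" using \<alpha> by (simp add: field_simps)
    ultimately have u: "\<alpha> < - inverse x - 1" by simp
    have "farey_fin \<alpha> v \<in> tower \<alpha>"
      using u c g unfolding T tower_def
      by (auto simp: generic_def intro!: exI[of _ 1])
    moreover have "snd (farey_fin \<alpha> v) < - 1"
      using bd(3) by (auto simp: T field_simps)
    moreover have "farey_fin \<alpha> v \<in> generic \<alpha>" using g by (auto simp: T generic_def)
    ultimately show ?thesis using c 1 xy
      by (auto simp: backward_index_def forward_index_def core_def)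
  next
    case 2
    have T: "farey_fin \<alpha> v = (inverse (inverse x - 1), inverse (inverse y - 1))"
      using 2 by (simp add: farey_fin_def forward_index_def branch_def xy inv2_def add2_def neg2_def)
    have u: "\<alpha> < inverse x - 1" using 2 \<alpha> by (simp add: field_simps)
    have gT: "farey_fin \<alpha> v \<in> generic \<alpha>" using g by (auto simp: T generic_def)
    have "farey_fin \<alpha> v \<in> tower \<alpha>"
    proof (cases "v \<in> core \<alpha>")
      case True
      then show ?thesis using u gT xy unfolding T tower_def by (auto intro!: exI[of _ 1])
    next
      case False
      then have tw: "(x, y) \<in> tower \<alpha>" using v by (simp add: xy)
      obtain i :: nat and e where i: "1 \<le> i" "e \<in> {1, -1}"
        "(e * inverse (inverse x + i), e * inverse (inverse y + i)) \<in> core \<alpha>"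
        by (rule towerE[OF tw], rule that)
      then show ?thesis using u gT unfolding T tower_def
        by (auto intro!: exI[of _ "Suc i"] bexI[of _ e])
    qed
    moreover have "- 1 < snd (farey_fin \<alpha> v)" using y0 by (simp add: T field_simps)
    moreover have "farey_fin \<alpha> v \<notin> Omega_fin \<alpha>"
      using core_bounds(3)[of "fst (farey_fin \<alpha> v)" "snd (farey_fin \<alpha> v)"] gT calculation(2)
      by (auto simp: core_def)
    ultimately show ?thesis using 2 xy
      by (auto simp: backward_index_def forward_index_def)
  next
    case 3
    have T: "farey_fin \<alpha> v = (inverse x - 1, inverse y - 1)"
    proof -
      have "0 < 1 / (1 + \<alpha>)" using \<alpha> by simp
      then have "\<not> x < 0" using 3 by linarith
      then show ?thesis
        using 3 by (simp add: farey_fin_def forward_index_def branch_def xy inv2_def add2_def neg2_def)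
    qed
    \<comment> \<open>Since x < \<alpha> < 1 / (1 + \<alpha>) on \<open>core\<close>, only tower
      points occur in this case.\<close>
    have "\<alpha> * (1 + \<alpha>) < 1 / 2 * (1 + 1)" using \<alpha> by (intro mult_strict_mono) auto
    then have "\<alpha> < 1 / (1 + \<alpha>)" using \<alpha> by (simp add: field_simps)
    then have "x > \<alpha>" using 3 by simp
    then have "v \<notin> core \<alpha>" using core_bounds(2)[of x y] xy by auto
    then have tw: "(x, y) \<in> tower \<alpha>" using v by (simp add: xy)
    obtain i :: nat and e where i: "1 \<le> i" "e \<in> {1, -1}"
      "(e * inverse (inverse x + i), e * inverse (inverse y + i)) \<in> core \<alpha>" and u: "\<alpha> < inverse x"
      by (rule towerE[OF tw], rule that)
    have "inverse x \<le> inverse (1 / (1 + \<alpha>))" using 3 \<alpha> by (intro le_imp_inverse_le) auto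
    then have up: "inverse x \<le> 1 + \<alpha>" by simp
    have "1 + \<alpha> \<in> mobius_pts \<alpha>" by simp
    then have "inverse x \<noteq> 1 + \<alpha>" using g(1) mobius_pts_inverse[of x \<alpha>] by metis
    then have up: "inverse x < 1 + \<alpha>" using up by simp
    \<comment> \<open>The base point below (x, y): the floors above it are the successive Farey
      images, and its continued fraction digit is i + 1 because \<alpha> < 1 / x < 1 +
      \<alpha>.\<close>
    define p q where "p = e * inverse (inverse x + i)" and "q = e * inverse (inverse y + i)"
    have inv: "e * inverse p = inverse x + i" "e * inverse q = inverse y + i"
      using i(2) by (auto simp: p_def q_def)
    have pe: "0 < e * p" using i(2) u \<alpha> by (auto simp: p_def)
    note c = i(3)[folded p_def q_def]
    have "(e * inverse p - real (i + 1), e * inverse q - real (i + 1)) \<in> core \<alpha>"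
      by (rule core_forward[OF c i(2) pe]; unfold inv) (use u up in simp_all)
    then have "(inverse x + real i - real (i + 1), inverse y + real i - real (i + 1)) \<in> core \<alpha>"
      unfolding inv .
    then have "farey_fin \<alpha> v \<in> core \<alpha>" by (simp add: T)
    then show ?thesis using 3 \<open>x > \<alpha>\<close> \<alpha> by (auto simp: backward_index_def forward_index_def core_def xy)
  qed
qed

text \<open>A point of the base comes from the floor b - 1 over its continued fraction predecessor
  with digit b; a point on floor i comes from floor i - 1, or from the base if i = 1. The case i =
  1, e = -1 is the one with y < -1, so the guessed branch is always a correct preimage, without
  exceptional set.\<close>

lemma farey_inv_in:
  assumes v: "v \<in> core \<alpha> \<union> tower \<alpha>"
  shows "farey_inv \<alpha> v \<in> core \<alpha> \<union> tower \<alpha> \<and> forward_index \<alpha> (fst (farey_inv \<alpha> v)) = backward_index \<alpha> v"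
proof -
  obtain x y where xy: "v = (x, y)" by (cases v)
  have g: "x \<notin> mobius_pts \<alpha>" "y \<notin> mobius_pts \<alpha>"
    using v by (auto simp: xy core_def tower_def generic_def)
  show ?thesis
  proof (cases "v \<in> Omega_fin \<alpha>")
    case True
    then have c: "(x, y) \<in> core \<alpha>" using g by (simp add: xy core_def generic_def)
    note bd = core_bounds[OF c]
    have S: "farey_inv \<alpha> v = (inverse (x + 1), inverse (y + 1))"
      using True by (simp add: farey_inv_def backward_index_def branch_inv_def xy inv2_def add2_def)
    obtain e :: real and b :: nat where eb: "e \<in> {1, -1}" "2 \<le> b"
      "(e * inverse (real b + x), e * inverse (real b + y)) \<in> core \<alpha>"
      using core_backward[OF c] by blast
    \<comment> \<open>The floor b - 1 exists because b \<ge> 2.\<close>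
    have "farey_inv \<alpha> v \<in> tower \<alpha>"
      using bd g eb \<alpha> unfolding S tower_def
      by (auto simp: generic_def of_nat_diff algebra_simps intro!: exI[of _ "b - 1"] bexI[of _ e])
    moreover have "1 / (1 + \<alpha>) < inverse (x + 1)" using bd \<alpha> by (simp add: field_simps)
    ultimately show ?thesis using True bd \<alpha>
      by (auto simp: S backward_index_def forward_index_def field_simps)
  next
    case False
    then have "v \<notin> core \<alpha>" by (simp add: core_def)
    then have tw: "(x, y) \<in> tower \<alpha>" using v by (simp add: xy)
    obtain i :: nat and e where i: "1 \<le> i" "e \<in> {1, -1}"
      "(e * inverse (inverse x + i), e * inverse (inverse y + i)) \<in> core \<alpha>" and u: "\<alpha> < inverse x"
      by (rule towerE[OF tw], rule that)
    have x0: "0 < x" using u \<alpha> by (metis inverse_positive_iff_positive less_trans)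
    have lt: "e * inverse (inverse y + i) < - 1" using core_bounds(3)[OF i(3)] .
    have y0: "y \<noteq> 0" using g by auto
    show ?thesis
    proof (cases "i = 1 \<and> e = - 1")
      case True
      then have l: "1 < inverse (inverse y + 1)" using lt by auto
      then have "0 < inverse y + 1" "inverse y + 1 < 1" by (auto simp: one_less_inverse_iff)
      then have "- 1 < inverse y" "y < 0" by auto
      then have "y < - 1" by (simp add: field_simps)
      then have S: "farey_inv \<alpha> v = (- inverse (inverse x + 1), - inverse (inverse y + 1))"
        and b: "backward_index \<alpha> v = 1"
        using False by (auto simp: farey_inv_def backward_index_def branch_inv_def xy inv2_def add2_def neg2_def)
      have "farey_inv \<alpha> v \<in> core \<alpha>" using i True by (simp add: S)
      moreover have "fst (farey_inv \<alpha> v) < 0" using x0 by (simp add: S add_pos_pos)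
      ultimately show ?thesis by (simp add: b forward_index_def)
    next
      case F: False
      \<comment> \<open>Otherwise 1 / y + i is positive and less than 1 with -1 < 1 / y < 0, which
        leaves only i = 1 and e = -1.\<close>
      have "\<not> y < - 1"
      proof
        assume "y < - 1"
        then have iy: "- 1 < inverse y" "inverse y < 0" by (auto simp: field_simps)
        then have "0 < inverse y + i" using i(1) by linarith
        then have "e = - 1" "inverse y + i < 1" using core_second_less_1[OF i(3,2)] by auto
        then have "i = 1" using iy i(1) by linarith
        then show False using F \<open>e = - 1\<close> by simp
      qed
      then have S: "farey_inv \<alpha> v = (inverse (inverse x + 1), inverse (inverse y + 1))"
        and b: "backward_index \<alpha> v = 2"
        using False by (auto simp: farey_inv_def backward_index_def branch_inv_def xy inv2_def add2_def neg2_def)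
      have gS: "farey_inv \<alpha> v \<in> generic \<alpha>" using g by (simp add: S generic_def)
      have "farey_inv \<alpha> v \<in> core \<alpha> \<union> tower \<alpha>"
      proof (cases "i = 1")
        case True
        then show ?thesis using F i by (auto simp: S)
      next
        case False
        then show ?thesis using i u gS unfolding S tower_def
          by (auto simp: of_nat_diff algebra_simps intro!: exI[of _ "i - 1"] bexI[of _ e])
      qed
      moreover have "inverse (inverse x + 1) < 1 / (1 + \<alpha>)" "0 < inverse (inverse x + 1)"
        using u x0 \<alpha> by (auto simp: inverse_eq_divide intro!: divide_strict_left_mono mult_pos_pos add_pos_pos)
      ultimately show ?thesis by (auto simp: b S forward_index_def)
    qed
  qed
qed

end

section \<open>The domain of the planar map\<close>

abbreviation ereal_borel :: "(real \<times> ereal) measure" where "ereal_borel \<equiv> borel \<Otimes>\<^sub>M borel"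

lemma measurable_recip [measurable]: "recip \<in> borel_measurable borel"
  unfolding recip_def by measurable

lemma measurable_Omega [measurable]: "Omega \<alpha> \<in> sets (borel \<Otimes>\<^sub>M borel)"
  unfolding borel_prod Omega_def by (rule borel_closed) simp

lemma ereal_eq_iff_real: "(\<exists>t. z = ereal t \<and> P t) \<longleftrightarrow> \<bar>z\<bar> \<noteq> \<infinity> \<and> P (real_of_ereal z)"
  by (cases z) auto

lemma measurable_Omega_star [measurable]: "Omega_star \<alpha> \<in> sets ereal_borel"
proof -
  have "Omega_star \<alpha> = {v \<in> space ereal_borel. snd v \<le> 0 \<and> \<bar>recip (- snd v)\<bar> \<noteq> \<infinity> \<and>
      (fst v, real_of_ereal (recip (- snd v))) \<in> Omega \<alpha>}"
    by (auto simp: Omega_star_def ereal_eq_iff_real space_pair_measure)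
  also have "\<dots> \<in> sets ereal_borel" by measurable
  finally show ?thesis .
qed

lemma measurable_cylinders [measurable]: "cyl_plus \<alpha> k \<in> sets ereal_borel" "cyl_minus \<alpha> k \<in> sets ereal_borel"
proof -
  have "{(x, y) \<in> Omega_star \<alpha>. P x} = {v \<in> space ereal_borel. v \<in> Omega_star \<alpha> \<and> P (fst v)}" for P
    by (auto simp: space_pair_measure)
  then show "cyl_plus \<alpha> k \<in> sets ereal_borel" "cyl_minus \<alpha> k \<in> sets ereal_borel"
    unfolding cyl_plus_def cyl_minus_def by simp_all
qed

lemma measurable_Omega_hat [measurable]:
  "Omega_hat_plus \<alpha> k \<in> sets ereal_borel" "Omega_hat_minus \<alpha> k \<in> sets ereal_borel"
proof -
  have "Omega_hat_plus \<alpha> k = {v \<in> space ereal_borel. (1 / fst v, recip (snd v)) \<in> cyl_plus \<alpha> k}"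
    "Omega_hat_minus \<alpha> k = {v \<in> space ereal_borel. (- 1 / fst v, recip (- snd v)) \<in> cyl_minus \<alpha> k}"
    by (auto simp: Omega_hat_plus_def Omega_hat_minus_def space_pair_measure)
  moreover have "{v \<in> space ereal_borel. (1 / fst v, recip (snd v)) \<in> cyl_plus \<alpha> k} \<in> sets ereal_borel"
    "{v \<in> space ereal_borel. (- 1 / fst v, recip (- snd v)) \<in> cyl_minus \<alpha> k} \<in> sets ereal_borel"
    by measurable
  ultimately show "Omega_hat_plus \<alpha> k \<in> sets ereal_borel" "Omega_hat_minus \<alpha> k \<in> sets ereal_borel"
    by simp_all
qed

lemma in_shift_down_iff: "(x, y) \<in> shift_down c S \<longleftrightarrow> (x + c, y + ereal c) \<in> S"
proof -
  have "y + ereal c - ereal c = y" for y by (cases y) auto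
  moreover have "y - ereal c + ereal c = y" for y by (cases y) auto
  ultimately show ?thesis unfolding shift_down_def
    by (auto simp: image_iff intro!: bexI[of _ "(x + c, y + ereal c)"])
qed

lemma measurable_shift_down [measurable]:
  assumes [measurable]: "S \<in> sets ereal_borel"
  shows "shift_down c S \<in> sets ereal_borel"
proof -
  have "shift_down c S = {v \<in> space ereal_borel. (fst v + c, snd v + ereal c) \<in> S}"
    by (auto simp: in_shift_down_iff space_pair_measure)
  also have "\<dots> \<in> sets ereal_borel" by measurable
  finally show ?thesis .
qed

lemma measurable_Upsilon [measurable]: "Upsilon \<alpha> \<in> sets ereal_borel"
  unfolding Upsilon_def Upsilon_part_def by (intro sets.countable_UN'' sets.Un) auto

lemma measurable_V: "V \<alpha> \<in> sets borel"
proof -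
  have "Upsilon_inv \<alpha> = {v \<in> space ereal_borel. snd v \<le> 0 \<and> (1 / fst v, recip (snd v)) \<in> Upsilon \<alpha>}"
    by (auto simp: Upsilon_inv_def space_pair_measure)
  also have "\<dots> \<in> sets ereal_borel" by measurable
  finally show ?thesis unfolding V_def borel_prod[symmetric] by (intro sets.Un measurable_Omega_star)
qed

lemma V_nonpos: "(x, y) \<in> V \<alpha> \<Longrightarrow> y \<le> 0"
  by (auto simp: V_def Omega_star_def Upsilon_inv_def)

lemma recip_ereal: "y \<noteq> 0 \<Longrightarrow> recip (ereal y) = ereal (inverse y)"
  by (simp add: recip_def one_ereal_def divide_inverse)

lemma Omega_star_ereal: "y \<noteq> 0 \<Longrightarrow> (x, ereal y) \<in> Omega_star \<alpha> \<longleftrightarrow> (x, y) \<in> Omega_fin \<alpha>"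
  using recip_ereal[of "- y"] by (auto simp: Omega_star_def Omega_fin_def divide_inverse)

section \<open>Generic points of \<open>V\<close> are those of \<open>core\<close> and
  \<open>tower\<close>\<close>

context
  fixes \<alpha> :: real
  assumes \<alpha>: "0 < \<alpha>" "\<alpha> < 1 / 2"
begin

text \<open>The defining inequalities make \<open>k0\<close> the ceiling of 1 / \<alpha> - \<alpha>,
  hence the witness. The case k = 0 is separate because k - 1 + \<alpha> is negative there and
  reciprocals do not reverse the inequality.\<close>

lemma k0_bounds: "real (k0 \<alpha>) - 1 + \<alpha> < 1 / \<alpha>" "1 / \<alpha> \<le> real (k0 \<alpha>) + \<alpha>"
proof -
  have iff: "1 / (real k + \<alpha>) \<le> \<alpha> \<and> \<alpha> < 1 / (real k - 1 + \<alpha>) \<longleftrightarrow>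
      real k - 1 + \<alpha> < 1 / \<alpha> \<and> 1 / \<alpha> \<le> real k + \<alpha>" for k
  proof (cases "k = 0")
    case True
    have "1 / (\<alpha> - 1) < 0" "1 < 1 / \<alpha>" using \<alpha> by simp_all
    then have "\<not> \<alpha> < 1 / (\<alpha> - 1)" "\<not> 1 / \<alpha> \<le> \<alpha>" using \<alpha> by linarith+
    then show ?thesis using True by simp
  next
    case False
    then have "0 < real k - 1 + \<alpha>" "0 < real k + \<alpha>" using \<alpha> by auto
    then show ?thesis using \<alpha> by (auto simp: field_simps)
  qed
  have "\<exists>!k. real k - 1 + \<alpha> < 1 / \<alpha> \<and> 1 / \<alpha> \<le> real k + \<alpha>"
  proof
    have "1 / \<alpha> - \<alpha> > 0" using \<alpha> by (smt (verit) le_divide_eq_1_pos)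
    then show "real (nat \<lceil>1 / \<alpha> - \<alpha>\<rceil>) - 1 + \<alpha> < 1 / \<alpha> \<and> 1 / \<alpha> \<le> real (nat \<lceil>1 / \<alpha> - \<alpha>\<rceil>) + \<alpha>"
      by linarith
  qed linarith
  from theI'[OF this[folded iff], folded k0_def, unfolded iff]
  show "real (k0 \<alpha>) - 1 + \<alpha> < 1 / \<alpha>" "1 / \<alpha> \<le> real (k0 \<alpha>) + \<alpha>" by auto
qed

lemma generic_inverse_core:
  assumes "(x, y) \<in> generic \<alpha>" "e \<in> {1, -1}"
  shows "(e * inverse x, ereal (e * inverse y)) \<in> Omega_star \<alpha> \<longleftrightarrow> (e * inverse x, e * inverse y) \<in> core \<alpha>"
proof -
  have "y \<noteq> 0" using assms(1) by (auto simp: generic_def)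
  then have "e * inverse y \<noteq> 0" using assms(2) by auto
  then show ?thesis using assms by (auto simp: Omega_star_ereal core_def generic_def)
qed

text \<open>In the reciprocal coordinate every cylinder is a unit band. The special cases k < k0 and
  k = k0 are absorbed because core points lie left of \<alpha>, so their reciprocals exceed 1 /
  \<alpha>; the band ends are in \<open>mobius_pts\<close>, so strict and weak inequalities
  agree.\<close>

lemma Omega_hat_plus_generic:
  assumes g: "(x, y) \<in> generic \<alpha>" and k: "2 \<le> k"
  shows "(x, ereal y) \<in> Omega_hat_plus \<alpha> k \<longleftrightarrow>
    (inverse x, inverse y) \<in> core \<alpha> \<and> real k - 1 + \<alpha> < x \<and> x < real k + \<alpha>"
proof -
  have y: "y \<noteq> 0" using g by (auto simp: generic_def)
  have L: "(x, ereal y) \<in> Omega_hat_plus \<alpha> k \<longleftrightarrow> (inverse x, ereal (inverse y)) \<in> cyl_plus \<alpha> k"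
    by (simp add: Omega_hat_plus_def recip_ereal y inverse_eq_divide)
  have c: "(inverse x, ereal (inverse y)) \<in> Omega_star \<alpha> \<longleftrightarrow> (inverse x, inverse y) \<in> core \<alpha>"
    using generic_inverse_core[OF g, of 1] by simp
  have pos: "0 < real k - 1 + \<alpha>" "0 < real k + \<alpha>" using k \<alpha> by auto
  have "real k - 1 + \<alpha> \<in> mobius_pts \<alpha>"
    using mobius_pts_shift(5)[of "real k - 1" \<alpha>] mobius_pts_shift(2)[of "k - 1" \<alpha> \<alpha>] k by (simp add: of_nat_diff)
  then have ne: "x \<noteq> real k - 1 + \<alpha>" using g by (auto simp: generic_def)
  show ?thesis
  proof (cases "0 < x")
    case False
    then have "inverse x \<le> 0" by simp
    moreover have "0 < 1 / (real k + \<alpha>)" using pos by simp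
    ultimately have "\<not> 1 / (real k + \<alpha>) < inverse x" by linarith
    then have "(inverse x, ereal (inverse y)) \<notin> cyl_plus \<alpha> k"
      by (auto simp: cyl_plus_def)
    then show ?thesis using L False pos by auto
  next
    case True
    have up: "1 / (real k + \<alpha>) < inverse x \<longleftrightarrow> x < real k + \<alpha>" using True pos by (simp add: field_simps)
    have lo: "inverse x \<le> 1 / (real k - 1 + \<alpha>) \<longleftrightarrow> real k - 1 + \<alpha> < x" using True pos ne by (auto simp: field_simps)
    have core: "1 / \<alpha> < x" if "(inverse x, inverse y) \<in> core \<alpha>"
      using core_bounds(2)[OF \<alpha> that] True \<alpha> by (simp add: field_simps)
    consider "k < k0 \<alpha>" | "k = k0 \<alpha>" | "k0 \<alpha> < k" by linarith
    then show ?thesis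
    proof cases
      case 1
      then have "real k + \<alpha> \<le> real (k0 \<alpha>) - 1 + \<alpha>" by simp
      then show ?thesis using 1 k0_bounds core L by (auto simp: cyl_plus_def)
    next
      case 2
      then show ?thesis using k0_bounds core L c up core_bounds(2)[OF \<alpha>] by (auto simp: cyl_plus_def)
    next
      case 3
      then show ?thesis using L c up lo by (auto simp: cyl_plus_def)
    qed
  qed
qed

text \<open>The exceptional end \<alpha> - 1 of the cylinder k = 2 disappears: core points satisfy
  it anyway, and 1 / (1 - \<alpha>) > 1 + \<alpha> puts them above the lower end of the
  band.\<close>

lemma Omega_hat_minus_generic:
  assumes g: "(x, y) \<in> generic \<alpha>" and k: "2 \<le> k"
  shows "(x, ereal y) \<in> Omega_hat_minus \<alpha> k \<longleftrightarrow>
    (- inverse x, - inverse y) \<in> core \<alpha> \<and> real k - 1 + \<alpha> < x \<and> x < real k + \<alpha>"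
proof -
  have y: "y \<noteq> 0" using g by (auto simp: generic_def)
  have L: "(x, ereal y) \<in> Omega_hat_minus \<alpha> k \<longleftrightarrow> (- inverse x, ereal (- inverse y)) \<in> cyl_minus \<alpha> k"
    using recip_ereal[of "- y"] y by (simp add: Omega_hat_minus_def inverse_eq_divide)
  have c: "(- inverse x, ereal (- inverse y)) \<in> Omega_star \<alpha> \<longleftrightarrow> (- inverse x, - inverse y) \<in> core \<alpha>"
    using generic_inverse_core[OF g, of "-1"] by simp
  have pos: "0 < real k - 1 + \<alpha>" "0 < real k + \<alpha>" using k \<alpha> by auto
  have "real k + \<alpha> \<in> mobius_pts \<alpha>" by simp
  then have ne: "x \<noteq> real k + \<alpha>" using g by (auto simp: generic_def)
  show ?thesis
  proof (cases "0 < x")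
    case False
    then have "0 \<le> - inverse x" by simp
    moreover have "- 1 / (real k + \<alpha>) < 0" using pos by simp
    ultimately have "\<not> - inverse x \<le> - 1 / (real k + \<alpha>)" by linarith
    then have "(- inverse x, ereal (- inverse y)) \<notin> cyl_minus \<alpha> k"
      by (auto simp: cyl_minus_def)
    then show ?thesis using L False pos by auto
  next
    case True
    have up: "- inverse x \<le> - 1 / (real k + \<alpha>) \<longleftrightarrow> x < real k + \<alpha>" using True pos ne by (auto simp: field_simps)
    have lo: "- 1 / (real k - 1 + \<alpha>) < - inverse x \<longleftrightarrow> real k - 1 + \<alpha> < x" using True pos by (auto simp: field_simps)
    have core: "1 + \<alpha> < x" "\<alpha> - 1 < - inverse x" if c: "(- inverse x, - inverse y) \<in> core \<alpha>"
    proof -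
      show *: "\<alpha> - 1 < - inverse x" using core_bounds(1)[OF \<alpha> c] .
      then have "1 < x * (1 - \<alpha>)" using True by (simp add: field_simps)
      moreover have "(1 + \<alpha>) * (1 - \<alpha>) < 1" using \<alpha> by (simp add: algebra_simps)
      ultimately have "(1 + \<alpha>) * (1 - \<alpha>) < x * (1 - \<alpha>)" by linarith
      then show "1 + \<alpha> < x" using \<alpha> by (simp add: mult_less_cancel_right)
    qed
    show ?thesis
    proof (cases "k = 2")
      case True
      then show ?thesis using L c up core by (auto simp: cyl_minus_def)
    next
      case False
      then show ?thesis using L c up lo by (auto simp: cyl_minus_def)
    qed
  qed
qed

text \<open>After the shift by k - j the band of cylinder k becomes j - 1 + \<alpha> < x < j +
  \<alpha>. These bands fill x > \<alpha> up to their ends, so j is determined by x and only the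
  floor i = k - j remains free.\<close>

lemma Upsilon_generic:
  assumes g: "(x, y) \<in> generic \<alpha>"
  shows "(x, ereal y) \<in> Upsilon \<alpha> \<longleftrightarrow>
    \<alpha> < x \<and> (\<exists>i :: nat. \<exists>e\<in>{1, -1}. 1 \<le> i \<and> (e * inverse (x + real i), e * inverse (y + real i)) \<in> core \<alpha>)"
proof -
  have g': "(x + (real k - real j), y + (real k - real j)) \<in> generic \<alpha>" if "j \<le> k" for j k :: nat
    using g mobius_pts_shift(1)[of x "k - j" \<alpha>] mobius_pts_shift(1)[of y "k - j" \<alpha>] that
    by (simp add: generic_def of_nat_diff)
  have step: "(x, ereal y) \<in> shift_down (real k - real j) (Omega_hat_minus \<alpha> k) \<or>
      (x, ereal y) \<in> shift_down (real k - real j) (Omega_hat_plus \<alpha> k) \<longleftrightarrow>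
    (\<exists>e\<in>{1, -1}. (e * inverse (x + (real k - real j)), e * inverse (y + (real k - real j))) \<in> core \<alpha>) \<and>
    real j - 1 + \<alpha> < x \<and> x < real j + \<alpha>" if "1 \<le> j" "j + 1 \<le> k" for j k :: nat
    using Omega_hat_plus_generic[OF g'[of j k], of k] Omega_hat_minus_generic[OF g'[of j k], of k] that
    by (auto simp: in_shift_down_iff)
  have U: "(x, ereal y) \<in> Upsilon \<alpha> \<longleftrightarrow> (\<exists>j\<ge>1. \<exists>k\<ge>j + 1.
      (x, ereal y) \<in> shift_down (real k - real j) (Omega_hat_minus \<alpha> k) \<or>
      (x, ereal y) \<in> shift_down (real k - real j) (Omega_hat_plus \<alpha> k))"
    unfolding Upsilon_def Upsilon_part_def by (simp add: Bex_def) blast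
  show ?thesis
  proof
    assume "(x, ereal y) \<in> Upsilon \<alpha>"
    then obtain j k :: nat where jk: "1 \<le> j" "j + 1 \<le> k"
      "\<exists>e\<in>{1, -1}. (e * inverse (x + (real k - real j)), e * inverse (y + (real k - real j))) \<in> core \<alpha>"
      "real j - 1 + \<alpha> < x"
      using U step by blast
    then have "real k - real j = real (k - j)" "1 \<le> k - j" "\<alpha> < x" by (auto simp: of_nat_diff)
    then show "\<alpha> < x \<and> (\<exists>i :: nat. \<exists>e\<in>{1, -1}. 1 \<le> i \<and> (e * inverse (x + real i), e * inverse (y + real i)) \<in> core \<alpha>)"
      using jk(3) by metis
  next
    assume a: "\<alpha> < x \<and> (\<exists>i :: nat. \<exists>e\<in>{1, -1}. 1 \<le> i \<and> (e * inverse (x + real i), e * inverse (y + real i)) \<in> core \<alpha>)"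
    then obtain i :: nat and e :: real where i: "e \<in> {1, -1}" "1 \<le> i" "(e * inverse (x + real i), e * inverse (y + real i)) \<in> core \<alpha>"
      by blast
    \<comment> \<open>The index of the band that contains x.\<close>
    define j where "j = nat \<lceil>x - \<alpha>\<rceil>"
    have j: "1 \<le> j" "real j - 1 + \<alpha> < x" "x \<le> real j + \<alpha>" using a unfolding j_def by linarith+
    have "real j + \<alpha> \<in> mobius_pts \<alpha>" by simp
    then have "x \<noteq> real j + \<alpha>" using g by (auto simp: generic_def)
    then have "x < real j + \<alpha>" using j by simp
    moreover have "real (j + i) - real j = real i" by simp
    ultimately have "(x, ereal y) \<in> shift_down (real (j + i) - real j) (Omega_hat_minus \<alpha> (j + i)) \<or>
      (x, ereal y) \<in> shift_down (real (j + i) - real j) (Omega_hat_plus \<alpha> (j + i))"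
      using step[of j "j + i"] i j by (metis add_left_mono)
    then show "(x, ereal y) \<in> Upsilon \<alpha>" using U j(1) i(2) by (metis add_left_mono)
  qed
qed

lemma V_generic:
  assumes g: "(x, y) \<in> generic \<alpha>"
  shows "(x, ereal y) \<in> V \<alpha> \<longleftrightarrow> (x, y) \<in> core \<alpha> \<union> tower \<alpha>"
proof -
  have y: "y \<noteq> 0" using g by (auto simp: generic_def)
  have gi: "(inverse x, inverse y) \<in> generic \<alpha>" using g by (simp add: generic_def)
  have U: "(1 / x, recip (ereal y)) \<in> Upsilon \<alpha> \<longleftrightarrow> (x, y) \<in> tower \<alpha>"
    using Upsilon_generic[OF gi] g y by (simp add: recip_ereal tower_def inverse_eq_divide[symmetric])
  have S: "(x, ereal y) \<in> Omega_star \<alpha> \<longleftrightarrow> (x, y) \<in> core \<alpha>"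
    using y g by (simp add: Omega_star_ereal core_def)
  show ?thesis using U tower_neg[OF \<alpha>, of x y] S by (auto simp: V_def Upsilon_inv_def)
qed

end

section \<open>Injectivity up to null sets\<close>

text \<open>A count of multiplicity: the sum of the indicators of the \<open>W i\<close> is at least
  1 on \<open>A\<close> and at least 2 on the overlap \<open>Z\<close>. Integrating gives M(A) +
  M(Z) \<le> M(A), and finiteness of M(A) allows cancelling.\<close>

lemma overlap_null:
  fixes M :: "'a measure" and W :: "'i \<Rightarrow> 'a set"
  assumes I: "countable I" and W [measurable]: "\<And>i. i \<in> I \<Longrightarrow> W i \<in> sets M" and A [measurable]: "A \<in> sets M"
    and sub: "A \<subseteq> (\<Union>i\<in>I. W i)"
    and le: "(\<integral>\<^sup>+i. emeasure M (W i) \<partial>count_space I) \<le> emeasure M A" and fin: "emeasure M A < \<infinity>"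
    and ij: "i \<in> I" "j \<in> I" "i \<noteq> j"
  shows "W i \<inter> W j \<inter> A \<in> null_sets M"
proof -
  define Z where "Z = W i \<inter> W j \<inter> A"
  have Z: "Z \<in> sets M" using ij by (auto simp: Z_def)
  have ge: "of_nat (card F) \<le> (\<integral>\<^sup>+k. indicator (W k) x \<partial>count_space I)"
    if "finite F" "F \<subseteq> {k \<in> I. x \<in> W k}" for F x
  proof -
    have "of_nat (card F) = emeasure (count_space I) F"
      using that by (subst emeasure_count_space) auto
    also have "\<dots> = (\<integral>\<^sup>+k. indicator F k \<partial>count_space I)"
      using that by (subst nn_integral_indicator) auto
    also have "\<dots> \<le> (\<integral>\<^sup>+k. indicator (W k) x \<partial>count_space I)"
      using that by (intro nn_integral_mono) (auto simp: indicator_def)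
    finally show ?thesis .
  qed
  have pt: "indicator A x + indicator Z x \<le> (\<integral>\<^sup>+k. indicator (W k) x \<partial>count_space I)" for x
  proof (cases "x \<in> A")
    case False then show ?thesis by (simp add: Z_def)
  next
    case True
    show ?thesis
    proof (cases "x \<in> Z")
      case True
      then show ?thesis using ge[of "{i, j}" x] ij \<open>x \<in> A\<close> by (auto simp: Z_def)
    next
      case False
      obtain k where "k \<in> I" "x \<in> W k" using True sub by blast
      then show ?thesis using ge[of "{k}" x] True False by simp
    qed
  qed
  have "emeasure M A + emeasure M Z = (\<integral>\<^sup>+x. indicator A x + indicator Z x \<partial>M)"
    using Z by (subst nn_integral_add) auto
  also have "\<dots> \<le> (\<integral>\<^sup>+x. (\<integral>\<^sup>+k. indicator (W k) x \<partial>count_space I) \<partial>M)"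
    by (intro nn_integral_mono pt)
  also have "\<dots> = (\<integral>\<^sup>+k. (\<integral>\<^sup>+x. indicator (W k) x \<partial>M) \<partial>count_space I)"
    using I by (intro nn_integral_count_space_nn_integral) auto
  also have "\<dots> = (\<integral>\<^sup>+k. emeasure M (W k) \<partial>count_space I)"
    by (intro nn_integral_cong) (simp add: nn_integral_indicator)
  also note le
  finally have "emeasure M A + emeasure M Z \<le> emeasure M A + 0" by simp
  then have "emeasure M Z = 0" using fin by (subst (asm) ennreal_add_left_cancel_le) auto
  then show ?thesis using Z by (auto simp: Z_def[symmetric])
qed

lemma hyp_preserving_id: "hyp_preserving (\<lambda>v. v)"
  by (simp add: hyp_preserving_def)

lemmas hyp_preserving_intros = hyp_preserving_comp[OF hyp_preserving_add2]
  hyp_preserving_comp[OF hyp_preserving_inv2] hyp_preserving_comp[OF hyp_preserving_neg2] hyp_preserving_id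

lemma hyp_preserving_branch: "hyp_preserving (branch i)" "hyp_preserving (branch_inv i)"
proof -
  have "branch i = (if i = 1 then (\<lambda>v. inv2 (add2 (- 1) (inv2 (neg2 v))))
      else if i = 2 then (\<lambda>v. inv2 (add2 (- 1) (inv2 v))) else (\<lambda>v. add2 (- 1) (inv2 v)))"
    by (simp add: branch_def fun_eq_iff)
  moreover have "hyp_preserving (\<lambda>v. inv2 (add2 (- 1) (inv2 (neg2 v))))"
    "hyp_preserving (\<lambda>v. inv2 (add2 (- 1) (inv2 v)))" "hyp_preserving (\<lambda>v. add2 (- 1) (inv2 v))"
    by (intro hyp_preserving_intros)+
  ultimately show "hyp_preserving (branch i)" by simp
  have "branch_inv i = (if i = 1 then (\<lambda>v. neg2 (inv2 (add2 1 (inv2 v))))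
      else if i = 2 then (\<lambda>v. inv2 (add2 1 (inv2 v))) else (\<lambda>v. inv2 (add2 1 v)))"
    by (simp add: branch_inv_def fun_eq_iff)
  moreover have "hyp_preserving (\<lambda>v. neg2 (inv2 (add2 1 (inv2 v))))"
    "hyp_preserving (\<lambda>v. inv2 (add2 1 (inv2 v)))" "hyp_preserving (\<lambda>v. inv2 (add2 1 v))"
    by (intro hyp_preserving_intros)+
  ultimately show "hyp_preserving (branch_inv i)" by simp
qed

text \<open>The points with sign \<open>e\<close> and digit \<open>b\<close>, on which the continued
  fraction map is \<open>cell_map e b\<close>.\<close>

definition cell :: "real \<Rightarrow> real \<Rightarrow> nat \<Rightarrow> (real \<times> real) set" where
  "cell \<alpha> e b = {v \<in> core \<alpha>. 0 < e * fst v \<and> \<alpha> - 1 < e * inverse (fst v) - real b \<and>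
     e * inverse (fst v) - real b < \<alpha>}"

definition cell_map :: "real \<Rightarrow> nat \<Rightarrow> real \<times> real \<Rightarrow> real \<times> real" where
  "cell_map e b v = (e * inverse (fst v) - real b, e * inverse (snd v) - real b)"

definition cell_inv :: "real \<Rightarrow> nat \<Rightarrow> real \<times> real \<Rightarrow> real \<times> real" where
  "cell_inv e b v = (e * inverse (real b + fst v), e * inverse (real b + snd v))"

lemma cell_inv_map: "e \<in> {1, -1} \<Longrightarrow> cell_inv e b (cell_map e b v) = v"
  by (auto simp: cell_inv_def cell_map_def)

lemma hyp_preserving_cell:
  assumes "e \<in> {1, -1}"
  shows "hyp_preserving (cell_map e b)" "hyp_preserving (cell_inv e b)"
proof -
  define s where "s = (if e = 1 then (\<lambda>v. v) else neg2)"
  have s: "hyp_preserving s" by (simp add: s_def hyp_preserving_id hyp_preserving_neg2)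
  have "cell_map e b = (\<lambda>v. add2 (- real b) (s (inv2 v)))"
    "cell_inv e b = (\<lambda>v. s (inv2 (add2 (real b) v)))"
    using assms by (auto simp: cell_map_def cell_inv_def s_def add2_def inv2_def neg2_def fun_eq_iff add.commute)
  moreover have "hyp_preserving (\<lambda>v. add2 (- real b) (s (inv2 v)))"
    "hyp_preserving (\<lambda>v. s (inv2 (add2 (real b) v)))"
    by (intro hyp_preserving_intros hyp_preserving_comp[OF s])+
  ultimately show "hyp_preserving (cell_map e b)" "hyp_preserving (cell_inv e b)" by simp_all
qed

lemma generic_borel [measurable]: "generic \<alpha> \<in> sets borel"
proof -
  have "- generic \<alpha> \<in> sets borel" using null_setsD2[OF null_sets_not_generic] by simp
  from borel_comp[OF this] show ?thesis by simp
qed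

lemma Omega_fin_borel [measurable]: "Omega_fin \<alpha> \<in> sets borel"
proof -
  have "Omega_fin \<alpha> = {v \<in> space (borel \<Otimes>\<^sub>M borel). snd v < 0 \<and> (fst v, - 1 / snd v) \<in> Omega \<alpha>}"
    by (auto simp: Omega_fin_def space_pair_measure)
  also have "\<dots> \<in> sets (borel \<Otimes>\<^sub>M borel)" by measurable
  finally show ?thesis by (simp only: borel_prod)
qed

lemma core_borel [measurable]: "core \<alpha> \<in> sets borel"
  by (simp add: core_def)

lemma cell_borel [measurable]: "cell \<alpha> e b \<in> sets borel"
proof -
  have "core \<alpha> \<in> sets (borel \<Otimes>\<^sub>M borel)" using core_borel by (simp only: borel_prod)
  then have [measurable]: "Measurable.pred (borel \<Otimes>\<^sub>M borel) (\<lambda>v. v \<in> core \<alpha>)" by simp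
  have "cell \<alpha> e b = {v \<in> space (borel \<Otimes>\<^sub>M borel). v \<in> core \<alpha> \<and> 0 < e * fst v \<and>
     \<alpha> - 1 < e * inverse (fst v) - real b \<and> e * inverse (fst v) - real b < \<alpha>}"
    by (auto simp: cell_def space_pair_measure)
  also have "\<dots> \<in> sets (borel \<Otimes>\<^sub>M borel)" by measurable
  finally show ?thesis by (simp only: borel_prod)
qed

section \<open>Images of cells do not overlap\<close>

context
  fixes \<alpha> :: real
  assumes \<alpha>: "0 < \<alpha>" "\<alpha> < 1 / 2"
begin

text \<open>This rests on \<alpha> > 0: the strip \<alpha> - 1 \<le> x, y \<le> -1 avoids the
  diagonal.\<close>

lemma hyp_core_finite: "emeasure hyp (core \<alpha>) < \<infinity>"
proof -
  have "emeasure hyp (core \<alpha>) \<le> emeasure hyp ({\<alpha> - 1..\<alpha>} \<times> {..- 1})"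
  proof (rule emeasure_mono)
    show "core \<alpha> \<subseteq> {\<alpha> - 1..\<alpha>} \<times> {..- 1}"
    proof
      fix v assume "v \<in> core \<alpha>"
      then have "(fst v, snd v) \<in> core \<alpha>" by simp
      from core_bounds(1-3)[OF \<alpha> this] show "v \<in> {\<alpha> - 1..\<alpha>} \<times> {..- 1}" by (auto simp: mem_Times_iff)
    qed
    have "closed ({\<alpha> - 1..\<alpha>} \<times> {..- 1 :: real})" by (intro closed_Times) auto
    then show "{\<alpha> - 1..\<alpha>} \<times> {..- 1} \<in> sets hyp" by (simp add: borel_closed)
  qed
  also have "\<dots> < \<infinity>" using \<alpha> by (intro hyp_strip_finite) simp
  finally show ?thesis .
qed

lemma core_cell:
  assumes "(x, y) \<in> core \<alpha>" "e \<in> {1, -1}" "0 < e * x"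
  obtains b where "(x, y) \<in> cell \<alpha> e b"
proof -
  define b where "b = nat \<lfloor>e * inverse x + 1 - \<alpha>\<rfloor>"
  have pos: "0 < e * inverse x" using assms(2,3) by auto
  have b: "\<alpha> - 1 \<le> e * inverse x - real b" "e * inverse x - real b < \<alpha>"
    using pos \<alpha> unfolding b_def by linarith+
  have "e * inverse x - real b \<notin> mobius_pts \<alpha>" using core_bounds(4)[OF \<alpha> assms(1)] assms(2) by simp
  moreover have "\<alpha> - 1 \<in> mobius_pts \<alpha>" by simp
  ultimately have "e * inverse x - real b \<noteq> \<alpha> - 1" by metis
  then show thesis using that[of b] assms b by (auto simp: cell_def)
qed

text \<open>The preimages \<open>W\<close> under \<open>cell_inv\<close> are the images of the
  cells. The cells are disjoint subsets of \<open>core\<close>, their images keep the measure and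
  cover \<open>core\<close> by \<open>core_backward\<close>, so \<open>overlap_null\<close> applies.
  The pair of labels is the one that arises when the first Farey branch returns to
  \<open>core\<close> at once.\<close>

lemma overlap_cells_null:
  "cell_inv 1 c -` cell \<alpha> 1 c \<inter> cell_inv (- 1) (Suc c) -` cell \<alpha> (- 1) (Suc c) \<inter> core \<alpha> \<in> null_sets hyp"
proof -
  define I where "I = {1, -1 :: real} \<times> (UNIV :: nat set)"
  define C where "C i = cell \<alpha> (fst i) (snd i)" for i
  define W where "W i = cell_inv (fst i) (snd i) -` C i" for i
  have CI: "countable I" by (simp add: I_def)
  have pres: "hyp_preserving (cell_inv (fst i) (snd i))" if "i \<in> I" for i
    using that by (intro hyp_preserving_cell) (auto simp: I_def)
  have W: "W i \<in> sets hyp" "emeasure hyp (W i) = emeasure hyp (C i)" if "i \<in> I" for i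
    using pres[OF that] measurable_sets_borel[OF _ cell_borel]
    by (auto simp: hyp_preserving_def W_def C_def)
  have disj: "disjoint_family_on C I"
    unfolding disjoint_family_on_def
  proof (intro ballI impI equals0I)
    fix i i' v assume ii': "i \<in> I" "i' \<in> I" "i \<noteq> i'" "v \<in> C i \<inter> C i'"
    obtain e b e' b' x y where eq: "i = (e, b)" "i' = (e', b')" "v = (x, y)"
      by (cases i; cases i'; cases v)
    have "(e, b) \<in> I" "(e', b') \<in> I" and ne: "(e, b) \<noteq> (e', b')"
      and v: "(x, y) \<in> C (e, b)" "(x, y) \<in> C (e', b')"
      using ii' by (auto simp: eq)
    then have e: "e \<in> {1, -1}" "e' \<in> {1, -1}" by (auto simp: I_def)
    have "0 < e * x" "0 < e' * x" using v by (auto simp: C_def cell_def)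
    then have ee: "e = e'" using e by auto
    have "e * inverse x - real b < \<alpha>" "\<alpha> - 1 < e * inverse x - real b"
      "e * inverse x - real b' < \<alpha>" "\<alpha> - 1 < e * inverse x - real b'"
      using v ee by (auto simp: C_def cell_def)
    then have "real b < real b' + 1" "real b' < real b + 1" by linarith+
    then have "b = b'" by linarith
    then show False using ne ee by simp
  qed
  have UN: "(\<Union>i\<in>I. C i) \<subseteq> core \<alpha>" by (auto simp: C_def cell_def)
  have "(\<integral>\<^sup>+i. emeasure hyp (W i) \<partial>count_space I) = (\<integral>\<^sup>+i. emeasure hyp (C i) \<partial>count_space I)"
    using W by (intro nn_integral_cong) auto
  also have "\<dots> = emeasure hyp (\<Union>i\<in>I. C i)"
    by (intro emeasure_UN_countable[symmetric] disj CI) (simp add: C_def)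
  also have "\<dots> \<le> emeasure hyp (core \<alpha>)" using UN by (intro emeasure_mono) auto
  finally have le: "(\<integral>\<^sup>+i. emeasure hyp (W i) \<partial>count_space I) \<le> emeasure hyp (core \<alpha>)" .
  have sub: "core \<alpha> \<subseteq> (\<Union>i\<in>I. W i)"
  proof
    fix v assume v: "v \<in> core \<alpha>"
    obtain x y where xy: "v = (x, y)" by (cases v)
    obtain e :: real and b :: nat where eb: "e \<in> {1, -1}" "2 \<le> b"
      "(e * inverse (real b + x), e * inverse (real b + y)) \<in> core \<alpha>"
      using core_backward[OF \<alpha> v[unfolded xy]] by blast
    note bd = core_bounds[OF \<alpha> v[unfolded xy]]
    have "0 < inverse (real b + x)" using bd eb(2) \<alpha> by simp
    then have "cell_inv e b v \<in> cell \<alpha> e b"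
      using eb bd by (auto simp: cell_inv_def cell_def xy)
    then have "v \<in> W (e, b)" "(e, b) \<in> I" using eb by (auto simp: W_def C_def I_def)
    then show "v \<in> (\<Union>i\<in>I. W i)" by blast
  qed
  have "W (1, c) \<inter> W (- 1, Suc c) \<inter> core \<alpha> \<in> null_sets hyp"
    by (rule overlap_null[OF CI W(1) _ sub le hyp_core_finite]) (auto simp: I_def)
  then show ?thesis by (simp add: W_def C_def)
qed

text \<open>A point of \<open>\<Omega>\<^sup>*\<close> with \<open>x < 0\<close> whose Farey image lies again in \<open>\<Omega>\<^sup>*\<close> has the same image
  under the continued fraction map as that Farey image.\<close>

lemma return_after_one_null:
  obtains N where "N \<in> null_sets hyp" "{v \<in> core \<alpha>. fst v < 0 \<and> farey_fin \<alpha> v \<in> core \<alpha>} \<subseteq> N"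
proof
  \<comment> \<open>The overlap lies among the images; pulling it back by the measure-preserving
    \<open>cell_map\<close> gives a null set of starting points.\<close>
  define Z where "Z c = cell_inv 1 c -` cell \<alpha> 1 c \<inter> cell_inv (- 1) (Suc c) -` cell \<alpha> (- 1) (Suc c) \<inter> core \<alpha>" for c
  show "(\<Union>c. cell_map (- 1) (Suc c) -` Z c) \<in> null_sets hyp"
    using overlap_cells_null hyp_preserving_cell(1)[of "-1"]
    by (intro null_sets_UN null_sets_hyp_vimage) (auto simp: Z_def)
  show "{v \<in> core \<alpha>. fst v < 0 \<and> farey_fin \<alpha> v \<in> core \<alpha>} \<subseteq> (\<Union>c. cell_map (- 1) (Suc c) -` Z c)"
  proof safe
    fix x y assume v: "(x, y) \<in> core \<alpha>" and x: "fst (x, y) < 0" and T: "farey_fin \<alpha> (x, y) \<in> core \<alpha>"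
    note bd = core_bounds[OF \<alpha> v]
    define x' y' where "x' = inverse (- inverse x - 1)" and "y' = inverse (- inverse y - 1)"
    have T: "(x', y') \<in> core \<alpha>"
      using T x by (simp add: farey_fin_def forward_index_def branch_def inv2_def add2_def neg2_def x'_def y'_def)
    have i: "inverse x' = - inverse x - 1" "inverse y' = - inverse y - 1" by (simp_all add: x'_def y'_def)
    have "inverse x < - 1" using x bd \<alpha> by (auto simp: field_simps)
    then have "0 < inverse x'" using i by simp
    then have "0 < x'" by simp
    then obtain c where c: "(x', y') \<in> cell \<alpha> 1 c" using core_cell[OF T, of 1] by auto
    \<comment> \<open>From 1 / x' = -1 / x - 1: digit c of x' with sign 1 is digit c + 1 of x with
      sign -1.\<close>
    have c': "(x, y) \<in> cell \<alpha> (- 1) (Suc c)"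
      using c v x by (auto simp: cell_def i)
    have eq: "cell_map (- 1) (Suc c) (x, y) = cell_map 1 c (x', y')"
      by (simp add: cell_map_def i)
    have "cell_map 1 c (x', y') \<in> core \<alpha>"
      using core_forward[OF \<alpha> T, of 1 c] c by (auto simp: cell_map_def cell_def)
    then have "cell_map (- 1) (Suc c) (x, y) \<in> Z c"
      using c c' cell_inv_map[of "-1" "Suc c" "(x, y)"] cell_inv_map[of 1 c "(x', y')"]
      unfolding Z_def by (simp add: eq)
    then show "(x, y) \<in> (\<Union>c. cell_map (- 1) (Suc c) -` Z c)" by blast
  qed
qed

end

section \<open>An invertible subset of full measure\<close>

lemma null_sets_funpow_vimage:
  fixes T :: "'a \<Rightarrow> 'a"
  assumes "\<And>N. N \<in> null_sets M \<Longrightarrow> T -` N \<in> null_sets M" "N \<in> null_sets M"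
  shows "(T ^^ n) -` N \<in> null_sets M"
  using assms(2)
proof (induction n arbitrary: N)
  case (Suc n)
  have "(T ^^ Suc n) -` N = (T ^^ n) -` (T -` N)" by auto
  then show ?case using Suc.IH[OF assms(1)[OF Suc.prems]] by (simp only:)
qed simp

text \<open>Discarding every point whose T-orbit or S-orbit ever meets \<open>N\<close> costs a null
  set by nonsingularity. What remains is invariant, since mixed words such as S^n T collapse to
  S^(n-1), so that pure iterates suffice.\<close>

lemma invertible_on_full_subset:
  fixes T S :: "'a \<Rightarrow> 'a"
  assumes T: "\<And>N. N \<in> null_sets M \<Longrightarrow> T -` N \<in> null_sets M"
    and S: "\<And>N. N \<in> null_sets M \<Longrightarrow> S -` N \<in> null_sets M"
    and A: "A \<in> sets M" and N: "N \<in> null_sets M"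
    and inv: "\<And>v. v \<in> A - N \<Longrightarrow> T v \<in> A \<and> S v \<in> A \<and> S (T v) = v \<and> T (S v) = v"
  obtains X where "X \<in> sets M" "A - X \<in> null_sets M" "X \<subseteq> A - N"
    "\<forall>v\<in>X. T v \<in> X \<and> S v \<in> X \<and> S (T v) = v \<and> T (S v) = v"
proof -
  define Z where "Z = (\<Union>n. (T ^^ n) -` N) \<union> (\<Union>n. (S ^^ n) -` N)"
  have Z: "Z \<in> null_sets M"
    unfolding Z_def using null_sets_funpow_vimage[OF T N] null_sets_funpow_vimage[OF S N]
    by (intro null_sets.Un null_sets_UN) auto
  define X where "X = A - Z"
  have XI: "v \<in> X \<longleftrightarrow> v \<in> A \<and> (\<forall>n. (T ^^ n) v \<notin> N) \<and> (\<forall>n. (S ^^ n) v \<notin> N)" for v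
    by (auto simp: X_def Z_def)
  have XN: "X \<subseteq> A - N"
    using XI by (metis DiffI funpow_0 subsetI)
  have step: "T v \<in> X \<and> S v \<in> X \<and> S (T v) = v \<and> T (S v) = v" if v: "v \<in> X" for v
  proof -
    note i = inv[of v]
    have vN: "v \<in> A - N" using v XN by blast
    have "(T ^^ n) (T v) \<notin> N \<and> (S ^^ n) (S v) \<notin> N" for n
      using v XI funpow_Suc_right[of n T] funpow_Suc_right[of n S] by (metis comp_apply)
    moreover have "(S ^^ n) (T v) \<notin> N" for n
    proof (cases n)
      case 0
      have "(T ^^ 1) v \<notin> N" using v XI by blast
      then show ?thesis using 0 by simp
    next
      case (Suc m)
      then show ?thesis using i[OF vN] v XI by (simp add: funpow_Suc_right del: funpow.simps)
    qed
    moreover have "(T ^^ n) (S v) \<notin> N" for n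
    proof (cases n)
      case 0
      have "(S ^^ 1) v \<notin> N" using v XI by blast
      then show ?thesis using 0 by simp
    next
      case (Suc m)
      then show ?thesis using i[OF vN] v XI by (simp add: funpow_Suc_right del: funpow.simps)
    qed
    ultimately show ?thesis using i[OF vN] XI by blast
  qed
  show thesis
  proof (rule that)
    show "X \<in> sets M" unfolding X_def using A Z by auto
    have "A - X = A \<inter> Z" by (auto simp: X_def)
    then show "A - X \<in> null_sets M" using A Z by (simp add: null_set_Int1)
  qed (use XN step in auto)
qed

section \<open>Measurability and nonsingularity of the planar map\<close>

lemma borel_measurable_fst_snd [measurable]:
  "fst \<in> borel_measurable (borel :: (real \<times> real) measure)"
  "snd \<in> borel_measurable (borel :: (real \<times> real) measure)"
  unfolding borel_prod[symmetric] by measurable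

lemma borel_measurable_branch [measurable]:
  "branch i \<in> borel_measurable borel" "branch_inv i \<in> borel_measurable borel"
  using hyp_preserving_branch by (auto simp: hyp_preserving_def)

lemma borel_measurable_farey_fin [measurable]: "farey_fin \<alpha> \<in> borel_measurable borel"
proof -
  have "farey_fin \<alpha> = (\<lambda>v. if fst v < 0 then branch 1 v
      else if fst v < 1 / (1 + \<alpha>) then branch 2 v else branch 3 v)"
    by (simp add: fun_eq_iff farey_fin_def forward_index_def)
  also have "\<dots> \<in> borel_measurable borel" by measurable
  finally show ?thesis .
qed

lemma borel_measurable_farey_inv [measurable]: "farey_inv \<alpha> \<in> borel_measurable borel"
proof -
  have "farey_inv \<alpha> = (\<lambda>v. if v \<in> Omega_fin \<alpha> then branch_inv 3 v
      else if snd v < - 1 then branch_inv 1 v else branch_inv 2 v)"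
    by (simp add: fun_eq_iff farey_inv_def backward_index_def)
  also have "\<dots> \<in> borel_measurable borel" by measurable
  finally show ?thesis .
qed

lemma index_cases: "forward_index \<alpha> x \<in> {1, 2, 3}" "backward_index \<alpha> v \<in> {1, 2, 3}"
  by (auto simp: forward_index_def backward_index_def)

lemma null_sets_farey_vimage:
  assumes N: "N \<in> null_sets hyp"
  shows "farey_fin \<alpha> -` N \<in> null_sets hyp" "farey_inv \<alpha> -` N \<in> null_sets hyp"
proof -
  have U: "(\<Union>i. branch i -` N) \<in> null_sets hyp" "(\<Union>i. branch_inv i -` N) \<in> null_sets hyp"
    by (intro null_sets_UN null_sets_hyp_vimage[OF hyp_preserving_branch(1) N]
        null_sets_hyp_vimage[OF hyp_preserving_branch(2) N])+
  have N': "N \<in> sets borel" using null_setsD2[OF N] by simp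
  have m: "farey_fin \<alpha> -` N \<in> sets hyp" "farey_inv \<alpha> -` N \<in> sets hyp"
    using measurable_sets_borel[OF borel_measurable_farey_fin N'] measurable_sets_borel[OF borel_measurable_farey_inv N']
    by simp_all
  show "farey_fin \<alpha> -` N \<in> null_sets hyp"
    by (rule null_sets_subset[OF U(1) m(1)]) (unfold farey_fin_def vimage_def, blast)
  show "farey_inv \<alpha> -` N \<in> null_sets hyp"
    by (rule null_sets_subset[OF U(2) m(2)]) (unfold farey_inv_def vimage_def, blast)
qed

definition emb :: "real \<times> real \<Rightarrow> real \<times> ereal" where "emb v = (fst v, ereal (snd v))"

lemma emb_inj: "inj emb" by (auto simp: emb_def inj_def prod_eq_iff)

lemma emb_measurable [measurable]: "emb \<in> borel_measurable borel"
  unfolding emb_def[abs_def] borel_prod[symmetric] by measurable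

definition farey_domain :: "real \<Rightarrow> (real \<times> real) set" where
  "farey_domain \<alpha> = core \<alpha> \<union> tower \<alpha>"

text \<open>The two index equations go beyond invertibility: they cut the map on \<open>X\<close>
  into pieces that are a single branch both forwards and backwards, as the proof of invariance
  requires.\<close>

definition invertible_part :: "real \<Rightarrow> (real \<times> real) set \<Rightarrow> bool" where
  "invertible_part \<alpha> X \<longleftrightarrow> X \<in> sets borel \<and> farey_domain \<alpha> - X \<in> null_sets hyp \<and> X \<subseteq> farey_domain \<alpha> \<and>
     (\<forall>v\<in>X. farey_fin \<alpha> v \<in> X \<and> farey_inv \<alpha> v \<in> X \<and>
        farey_inv \<alpha> (farey_fin \<alpha> v) = v \<and> farey_fin \<alpha> (farey_inv \<alpha> v) = v \<and>
        backward_index \<alpha> (farey_fin \<alpha> v) = forward_index \<alpha> (fst v) \<and>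
        forward_index \<alpha> (fst (farey_inv \<alpha> v)) = backward_index \<alpha> v)"

lemma farey_domain_generic: "farey_domain \<alpha> \<subseteq> generic \<alpha>"
  by (auto simp: farey_domain_def core_def tower_def)

context
  fixes \<alpha> :: real
  assumes \<alpha>: "0 < \<alpha>" "\<alpha> < 1 / 2"
begin

lemma farey_domain_eq: "farey_domain \<alpha> = emb -` V \<alpha> \<inter> generic \<alpha>"
proof (intro set_eqI)
  fix v
  have "v \<in> farey_domain \<alpha> \<Longrightarrow> v \<in> generic \<alpha>" using farey_domain_generic by blast
  then show "v \<in> farey_domain \<alpha> \<longleftrightarrow> v \<in> emb -` V \<alpha> \<inter> generic \<alpha>"
    using V_generic[OF \<alpha>, of "fst v" "snd v"] by (auto simp: farey_domain_def emb_def)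
qed

lemma farey_domain_borel [measurable]: "farey_domain \<alpha> \<in> sets borel"
  using measurable_sets_borel[OF emb_measurable measurable_V] by (simp add: farey_domain_eq)

lemma ex_invertible_part: "\<exists>X. invertible_part \<alpha> X"
proof -
  obtain N where N: "N \<in> null_sets hyp" "{v \<in> core \<alpha>. fst v < 0 \<and> farey_fin \<alpha> v \<in> core \<alpha>} \<subseteq> N"
    using return_after_one_null[OF \<alpha>] .
  have T: "farey_fin \<alpha> v \<in> farey_domain \<alpha> \<and> backward_index \<alpha> (farey_fin \<alpha> v) = forward_index \<alpha> (fst v)"
    if "v \<in> farey_domain \<alpha> - N" for v
    using farey_fin_in[OF \<alpha>, of v] N(2) that by (auto simp: farey_domain_def)
  have S: "farey_inv \<alpha> v \<in> farey_domain \<alpha> \<and> forward_index \<alpha> (fst (farey_inv \<alpha> v)) = backward_index \<alpha> v"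
    if "v \<in> farey_domain \<alpha>" for v
    using farey_inv_in[OF \<alpha>, of v] that by (auto simp: farey_domain_def)
  have *: "farey_fin \<alpha> v \<in> farey_domain \<alpha> \<and> farey_inv \<alpha> v \<in> farey_domain \<alpha> \<and>
      farey_inv \<alpha> (farey_fin \<alpha> v) = v \<and> farey_fin \<alpha> (farey_inv \<alpha> v) = v"
    if v: "v \<in> farey_domain \<alpha> - N" for v
  proof -
    have "farey_inv \<alpha> (farey_fin \<alpha> v) = v"
      unfolding farey_inv_def[of \<alpha> "farey_fin \<alpha> v"] using T[OF v] by (simp add: farey_fin_def)
    moreover have "farey_fin \<alpha> (farey_inv \<alpha> v) = v"
      unfolding farey_fin_def[of \<alpha> "farey_inv \<alpha> v"] using S[of v] v by (simp add: farey_inv_def)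
    ultimately show ?thesis using T[OF v] S[of v] v by blast
  qed
  have D: "farey_domain \<alpha> \<in> sets hyp" using farey_domain_borel by simp
  obtain X where X: "X \<in> sets hyp" "farey_domain \<alpha> - X \<in> null_sets hyp" "X \<subseteq> farey_domain \<alpha> - N"
    and inv: "\<forall>v\<in>X. farey_fin \<alpha> v \<in> X \<and> farey_inv \<alpha> v \<in> X \<and>
      farey_inv \<alpha> (farey_fin \<alpha> v) = v \<and> farey_fin \<alpha> (farey_inv \<alpha> v) = v"
    using invertible_on_full_subset[OF null_sets_farey_vimage(1) null_sets_farey_vimage(2) D N(1) *] by blast
  have "invertible_part \<alpha> X"
    unfolding invertible_part_def
  proof (intro conjI ballI)
    fix v assume v: "v \<in> X"
    then have "v \<in> farey_domain \<alpha> - N" using X(3) by blast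
    from T[OF this] show "backward_index \<alpha> (farey_fin \<alpha> v) = forward_index \<alpha> (fst v)" by simp
    show "forward_index \<alpha> (fst (farey_inv \<alpha> v)) = backward_index \<alpha> v" using S X(3) v by blast
  qed (use X inv in auto)
  then show ?thesis by blast
qed

text \<open>The preimage is cut by forward index, the target by backward index. On \<open>X\<close>
  the i-th branch carries \<open>P i\<close> exactly onto \<open>Q i\<close>, so invariance follows
  branch by branch.\<close>

lemma invertible_part_preserves:
  assumes X: "invertible_part \<alpha> X" and A: "A \<in> sets borel"
  shows "emeasure hyp (farey_fin \<alpha> -` A \<inter> X) = emeasure hyp (A \<inter> X)"
proof -
  define P where "P i = farey_fin \<alpha> -` A \<inter> X \<inter> (\<lambda>v. forward_index \<alpha> (fst v)) -` {i}" for i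
  define Q where "Q i = A \<inter> X \<inter> backward_index \<alpha> -` {i}" for i
  have [measurable]: "X \<in> sets borel" using X by (simp add: invertible_part_def)
  have inv: "farey_fin \<alpha> v \<in> X" "farey_inv \<alpha> v \<in> X" "farey_inv \<alpha> (farey_fin \<alpha> v) = v"
      "farey_fin \<alpha> (farey_inv \<alpha> v) = v" "backward_index \<alpha> (farey_fin \<alpha> v) = forward_index \<alpha> (fst v)"
      "forward_index \<alpha> (fst (farey_inv \<alpha> v)) = backward_index \<alpha> v" if "v \<in> X" for v
    using X that by (auto simp: invertible_part_def)
  have PQ: "branch_inv i -` P i = Q i" for i
  proof (intro equalityI subsetI)
    fix w assume "w \<in> branch_inv i -` P i"
    then have p: "branch_inv i w \<in> X" "farey_fin \<alpha> (branch_inv i w) \<in> A" "forward_index \<alpha> (fst (branch_inv i w)) = i"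
      by (auto simp: P_def)
    have "farey_fin \<alpha> (branch_inv i w) = w" by (simp add: farey_fin_def p(3))
    then show "w \<in> Q i" using p inv[OF p(1)] by (auto simp: Q_def)
  next
    fix w assume "w \<in> Q i"
    then have w: "w \<in> A" "w \<in> X" "backward_index \<alpha> w = i" by (auto simp: Q_def)
    have "farey_inv \<alpha> w = branch_inv i w" by (simp add: farey_inv_def w(3))
    then show "w \<in> branch_inv i -` P i" using w inv[OF w(2)] by (auto simp: P_def)
  qed
  have "forward_index \<alpha> \<in> measurable borel (count_space UNIV)"
    unfolding forward_index_def[abs_def] by measurable
  from measurable_compose[OF borel_measurable_fst_snd(1) this]
  have fi: "(\<lambda>v :: real \<times> real. forward_index \<alpha> (fst v)) \<in> measurable borel (count_space UNIV)" .
  have "{v \<in> space borel. snd v < - 1} \<in> sets (borel :: (real \<times> real) measure)" by measurable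
  then have bi: "backward_index \<alpha> \<in> measurable borel (count_space UNIV)"
    unfolding backward_index_def[abs_def] by (intro measurable_If measurable_const) auto
  have TA: "farey_fin \<alpha> -` A \<in> sets borel" by (rule measurable_sets_borel[OF borel_measurable_farey_fin A])
  have P: "P i \<in> sets hyp" and Q: "Q i \<in> sets hyp" for i
    unfolding P_def Q_def using TA A measurable_sets_borel[OF fi, of "{i}"] measurable_sets_borel[OF bi, of "{i}"] by auto
  have "emeasure hyp (farey_fin \<alpha> -` A \<inter> X) = (\<Sum>i\<in>{1, 2, 3}. emeasure hyp (P i))"
  proof -
    have "farey_fin \<alpha> -` A \<inter> X = (\<Union>i\<in>{1, 2, 3}. P i)"
    proof (intro set_eqI)
      show "v \<in> farey_fin \<alpha> -` A \<inter> X \<longleftrightarrow> v \<in> (\<Union>i\<in>{1, 2, 3}. P i)" for v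
        using index_cases(1)[of \<alpha> "fst v"] by (auto simp: P_def)
    qed
    then show ?thesis
      using P by (simp only:) (rule sum_emeasure[symmetric]; force simp: disjoint_family_on_def P_def)
  qed
  also have "\<dots> = (\<Sum>i\<in>{1, 2, 3}. emeasure hyp (Q i))"
    using hyp_preserving_branch(2) P unfolding PQ[symmetric] hyp_preserving_def
    by (intro sum.cong refl) auto
  also have "\<dots> = emeasure hyp (A \<inter> X)"
  proof -
    have "A \<inter> X = (\<Union>i\<in>{1, 2, 3}. Q i)"
    proof (intro set_eqI)
      show "v \<in> A \<inter> X \<longleftrightarrow> v \<in> (\<Union>i\<in>{1, 2, 3}. Q i)" for v
        using index_cases(2)[of \<alpha> v] by (auto simp: Q_def)
    qed
    then show ?thesis
      using Q by (simp only:) (rule sum_emeasure; force simp: disjoint_family_on_def Q_def)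
  qed
  finally show ?thesis .
qed

end

section \<open>The past determines the present\<close>

text \<open>In the coordinate \<open>t = - 1 / y\<close> of the natural extension of continued fractions the Farey map
  acts on the fibres by \<open>1 - t\<close>, \<open>1 + t\<close> and \<open>1 / (1 + t)\<close>. On \<open>t \<ge> 0\<close> none of these increases
  distances, and \<open>1 / (1 + t)\<close> maps \<open>[0, \<infinity>)\<close> into \<open>[0, 1]\<close> and distance \<open>d\<close> to at most \<open>d / (1 + d)\<close>.\<close>

definition fibre_coord :: "real \<times> real \<Rightarrow> real" where
  "fibre_coord v = - inverse (snd v)"

definition fibre_map :: "real \<Rightarrow> real \<Rightarrow> real \<Rightarrow> real" where
  "fibre_map \<alpha> x t = (if x < 0 then 1 - t else if x < 1 / (1 + \<alpha>) then 1 + t else inverse (1 + t))"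

text \<open>A continued fraction convergent: the fibre coordinate n steps ago is replaced by 0 and
  pushed forward along the first coordinates of the past.\<close>

primrec past_approx :: "real \<Rightarrow> nat \<Rightarrow> real \<times> real \<Rightarrow> real" where
  "past_approx \<alpha> 0 v = 0"
| "past_approx \<alpha> (Suc n) v = fibre_map \<alpha> (fst (farey_inv \<alpha> v)) (past_approx \<alpha> n (farey_inv \<alpha> v))"

text \<open>Counts the uses of the third branch, the only contracting one, among the last n
  steps.\<close>

primrec past_returns :: "real \<Rightarrow> nat \<Rightarrow> real \<times> real \<Rightarrow> nat" where
  "past_returns \<alpha> 0 v = 0"
| "past_returns \<alpha> (Suc n) v = (if forward_index \<alpha> (fst (farey_inv \<alpha> v)) = 3 then 1 else 0)
     + past_returns \<alpha> n (farey_inv \<alpha> v)"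

lemma past_returns_add:
  "past_returns \<alpha> (m + n) v = past_returns \<alpha> m v + past_returns \<alpha> n ((farey_inv \<alpha> ^^ m) v)"
  by (induction m arbitrary: v) (auto simp: funpow_swap1)

lemma past_returns_mono: "m \<le> n \<Longrightarrow> past_returns \<alpha> m v \<le> past_returns \<alpha> n v"
  using past_returns_add[of \<alpha> m "n - m" v] by simp

text \<open>Since (1 + s) (1 + t) \<ge> 1 + s + t \<ge> 1 + d, the reciprocal of the distance grows
  by at least 1. The first bound starts the induction on returns, the second continues it.\<close>

lemma inverse_one_plus_contraction:
  fixes s t :: real
  assumes "0 \<le> s" "0 \<le> t"
  shows "\<bar>inverse (1 + s) - inverse (1 + t)\<bar> \<le> 1"
    and "0 < n \<Longrightarrow> \<bar>s - t\<bar> \<le> 1 / real n \<Longrightarrow> \<bar>inverse (1 + s) - inverse (1 + t)\<bar> \<le> 1 / (1 + real n)"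
proof -
  have "0 < inverse (1 + s)" "inverse (1 + s) \<le> 1" "0 < inverse (1 + t)" "inverse (1 + t) \<le> 1"
    using assms by (auto simp: inverse_le_1_iff)
  then show "\<bar>inverse (1 + s) - inverse (1 + t)\<bar> \<le> 1" by linarith
  assume n: "0 < n" "\<bar>s - t\<bar> \<le> 1 / real n"
  define d where "d = \<bar>s - t\<bar>"
  have d: "0 \<le> d" "d * n \<le> 1" using n by (auto simp: d_def field_simps)
  have "inverse (1 + s) - inverse (1 + t) = (t - s) / ((1 + s) * (1 + t))"
    using assms by (simp add: field_simps)
  then have "\<bar>inverse (1 + s) - inverse (1 + t)\<bar> = d / ((1 + s) * (1 + t))"
    using assms by (simp add: abs_divide abs_mult d_def abs_minus_commute)
  also have "\<dots> \<le> d / (1 + d)"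
  proof (rule divide_left_mono)
    have "0 \<le> s * t" using assms by simp
    moreover have "d \<le> s + t" using assms by (auto simp: d_def)
    ultimately show "1 + d \<le> (1 + s) * (1 + t)" by (simp add: algebra_simps)
  qed (use assms d in \<open>auto intro!: mult_pos_pos add_pos_nonneg\<close>)
  also have "\<dots> \<le> 1 / (1 + real n)"
    using d n(1) by (simp add: field_simps)
  finally show "\<bar>inverse (1 + s) - inverse (1 + t)\<bar> \<le> 1 / (1 + real n)" .
qed

context
  fixes \<alpha> :: real
  assumes \<alpha>: "0 < \<alpha>" "\<alpha> < 1 / 2"
begin

lemma farey_domain_bounds:
  assumes "(x, y) \<in> farey_domain \<alpha>"
  shows "x \<notin> mobius_pts \<alpha>" "y \<notin> mobius_pts \<alpha>" "y < 0" "\<alpha> - 1 < x" "x < 1 / \<alpha>" "x < 0 \<Longrightarrow> y < - 1"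
proof -
  show g: "x \<notin> mobius_pts \<alpha>" "y \<notin> mobius_pts \<alpha>"
    using assms farey_domain_generic by (auto simp: generic_def)
  have "y \<le> 0" using assms V_nonpos[of x "ereal y" \<alpha>] by (simp add: farey_domain_eq[OF \<alpha>] emb_def)
  moreover have "y \<noteq> 0" using g by auto
  ultimately show "y < 0" by simp
  consider (core) "(x, y) \<in> core \<alpha>" | (tower) "(x, y) \<in> tower \<alpha>" "\<alpha> < inverse x"
    using assms by (auto simp: farey_domain_def tower_def)
  then have "\<alpha> - 1 < x \<and> x < 1 / \<alpha> \<and> (x < 0 \<longrightarrow> y < - 1)"
  proof cases
    case core
    have "1 < 1 / \<alpha>" using \<alpha> by simp
    then show ?thesis using core_bounds[OF \<alpha> core] \<alpha> by linarith
  next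
    case tower
    then have "0 < inverse x" using \<alpha> by linarith
    then have "0 < x" by simp
    then show ?thesis using tower(2) \<alpha> by (auto simp: field_simps)
  qed
  then show "\<alpha> - 1 < x" "x < 1 / \<alpha>" "x < 0 \<Longrightarrow> y < - 1" by auto
qed

lemma fibre_coord_pos: "v \<in> farey_domain \<alpha> \<Longrightarrow> 0 < fibre_coord v"
  using farey_domain_bounds(3)[of "fst v" "snd v"] by (simp add: fibre_coord_def)

text \<open>The second part says that a negative first coordinate can only follow the third branch;
  this controls where 1 - t is applied.\<close>

lemma fibre_coord_farey_fin:
  assumes "v \<in> farey_domain \<alpha>"
  shows "fibre_coord (farey_fin \<alpha> v) = fibre_map \<alpha> (fst v) (fibre_coord v)"
    and "forward_index \<alpha> (fst v) \<noteq> 3 \<Longrightarrow> 0 < fst (farey_fin \<alpha> v)"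
proof -
  obtain x y where v: "v = (x, y)" by (cases v)
  note bd = farey_domain_bounds[OF assms[unfolded v]]
  show "fibre_coord (farey_fin \<alpha> v) = fibre_map \<alpha> (fst v) (fibre_coord v)"
  proof -
    have "- inverse (inverse y - 1) = inverse (1 - inverse y)"
      by (metis inverse_minus_eq minus_diff_eq)
    then show ?thesis
      by (auto simp: v fibre_coord_def fibre_map_def farey_fin_def forward_index_def branch_def
          inv2_def add2_def neg2_def)
  qed
  show "0 < fst (farey_fin \<alpha> v)" if i: "forward_index \<alpha> (fst v) \<noteq> 3"
  proof (cases "x < 0")
    case True
    then have "inverse x < - 1" using bd \<alpha> by (auto simp: field_simps)
    then have "0 < - inverse x - 1" by simp
    then show ?thesis using True
      by (simp add: v farey_fin_def forward_index_def branch_def inv2_def add2_def neg2_def)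
  next
    case False
    moreover have "x \<noteq> 0" using bd(1) by auto
    ultimately have x: "0 < x" "x < 1 / (1 + \<alpha>)" using i by (auto simp: v forward_index_def split: if_splits)
    have "1 / (1 + \<alpha>) < 1" using \<alpha> by simp
    then have "1 < inverse x" using x by (simp add: one_less_inverse_iff)
    then have "0 < inverse x - 1" by simp
    then show ?thesis using x
      by (simp add: v farey_fin_def forward_index_def branch_def inv2_def add2_def)
  qed
qed

section \<open>Approximating the fibre coordinate from the past\<close>

context
  fixes X
  assumes X: "invertible_part \<alpha> X"
begin

lemma X_facts:
  assumes "v \<in> X"
  shows "v \<in> farey_domain \<alpha>" "farey_fin \<alpha> v \<in> X" "farey_inv \<alpha> v \<in> X" "farey_inv \<alpha> (farey_fin \<alpha> v) = v"
    "farey_fin \<alpha> (farey_inv \<alpha> v) = v"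
  using X assms by (auto simp: invertible_part_def)

lemma X_borel: "X \<in> sets borel" using X by (simp add: invertible_part_def)

lemma fibre_coord_X:
  assumes "v \<in> X"
  shows "fibre_coord v = fibre_map \<alpha> (fst (farey_inv \<alpha> v)) (fibre_coord (farey_inv \<alpha> v))"
    and "forward_index \<alpha> (fst (farey_inv \<alpha> v)) \<noteq> 3 \<Longrightarrow> 0 < fst v"
  using fibre_coord_farey_fin[of "farey_inv \<alpha> v"] X_facts[OF assms] X_facts[OF X_facts(3)[OF assms]] by auto

text \<open>The contraction estimate needs t \<ge> 0, which only 1 - t could destroy. That map is
  used only at x < 0, where the approximation is the initial 0 or was just produced by 1 / (1 + t),
  hence at most 1.\<close>

lemma past_approx_bounds:
  assumes "v \<in> X"
  shows "0 \<le> past_approx \<alpha> n v \<and> (fst v < 0 \<longrightarrow> past_approx \<alpha> n v \<le> 1)"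
  using assms
proof (induction n arbitrary: v)
  case (Suc n)
  define w where "w = farey_inv \<alpha> v"
  have w: "w \<in> X" using X_facts Suc.prems by (simp add: w_def)
  note IH = Suc.IH[OF w]
  have f: "forward_index \<alpha> (fst w) \<noteq> 3 \<Longrightarrow> 0 < fst v" using fibre_coord_X(2)[OF Suc.prems] by (simp add: w_def)
  have "inverse (1 + past_approx \<alpha> n w) \<le> 1" using IH by (simp add: inverse_le_1_iff)
  then show ?case using IH f
    by (auto simp: w_def[symmetric] fibre_map_def forward_index_def split: if_splits)
qed simp

text \<open>The first two branches are isometries of the fibre, so arbitrarily long runs of them
  leave the bound unchanged; each return improves 1 / r to 1 / (r + 1).\<close>

lemma past_approx_error:
  assumes "v \<in> X" "0 < past_returns \<alpha> n v"
  shows "\<bar>fibre_coord v - past_approx \<alpha> n v\<bar> \<le> 1 / past_returns \<alpha> n v"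
  using assms
proof (induction n arbitrary: v)
  case (Suc n)
  define w where "w = farey_inv \<alpha> v"
  have w: "w \<in> X" using X_facts Suc.prems by (simp add: w_def)
  have eq: "fibre_coord v = fibre_map \<alpha> (fst w) (fibre_coord w)" using fibre_coord_X(1)[OF Suc.prems(1)] by (simp add: w_def)
  have pos: "0 \<le> fibre_coord w" using fibre_coord_pos X_facts(1)[OF w] less_imp_le by blast
  have pos': "0 \<le> past_approx \<alpha> n w" using past_approx_bounds[OF w] by blast
  note c = inverse_one_plus_contraction[OF pos pos']
  show ?case
  proof (cases "forward_index \<alpha> (fst w) = 3")
    case False
    have "\<bar>fibre_coord v - past_approx \<alpha> (Suc n) v\<bar> = \<bar>fibre_coord w - past_approx \<alpha> n w\<bar>"
      using False unfolding eq by (auto simp: w_def[symmetric] fibre_map_def forward_index_def split: if_splits)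
    moreover have "past_returns \<alpha> (Suc n) v = past_returns \<alpha> n w" using False by (simp add: w_def[symmetric])
    ultimately show ?thesis using Suc.IH[OF w] Suc.prems(2) by simp
  next
    case True
    have e: "\<bar>fibre_coord v - past_approx \<alpha> (Suc n) v\<bar> = \<bar>inverse (1 + fibre_coord w) - inverse (1 + past_approx \<alpha> n w)\<bar>"
      using True unfolding eq by (auto simp: w_def[symmetric] fibre_map_def forward_index_def split: if_splits)
    have r: "past_returns \<alpha> (Suc n) v = 1 + past_returns \<alpha> n w" using True by (simp add: w_def[symmetric])
    show ?thesis
    proof (cases "past_returns \<alpha> n w = 0")
      case True then show ?thesis using c(1) e r by simp
    next
      case False
      then show ?thesis using c(2)[of "past_returns \<alpha> n w"] Suc.IH[OF w] e r by simp
    qed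
  qed
qed simp

text \<open>Going back, \<open>1 + t\<close> can only be undone finitely often in a row, and \<open>1 - t\<close> is always preceded
  by \<open>1 / (1 + t)\<close>.\<close>

lemma ex_past_return:
  assumes "v \<in> X"
  shows "\<exists>n. 1 \<le> past_returns \<alpha> n v"
proof -
  have "\<forall>v\<in>X. fibre_coord v < real m \<longrightarrow> (\<exists>n. 1 \<le> past_returns \<alpha> n v)" for m
  proof (induction m)
    case 0
    then show ?case using fibre_coord_pos X_facts(1) less_asym by (metis of_nat_0)
  next
    case (Suc m)
    show ?case
    proof (intro ballI impI)
      fix v assume v: "v \<in> X" and lt: "fibre_coord v < real (Suc m)"
      define w where "w = farey_inv \<alpha> v"
      have w: "w \<in> X" using X_facts v by (simp add: w_def)
      consider "forward_index \<alpha> (fst w) = 1" | "forward_index \<alpha> (fst w) = 2" | "forward_index \<alpha> (fst w) = 3"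
        using index_cases(1)[of \<alpha> "fst w"] by blast
      then show "\<exists>n. 1 \<le> past_returns \<alpha> n v"
      proof cases
        case 1
        then have "fst w < 0" by (auto simp: forward_index_def split: if_splits)
        then have "forward_index \<alpha> (fst (farey_inv \<alpha> w)) = 3" using fibre_coord_X(2)[OF w] by auto
        then have "1 \<le> past_returns \<alpha> 2 v" by (simp add: numeral_2_eq_2 w_def)
        then show ?thesis by blast
      next
        case 2
        then have "fibre_coord v = 1 + fibre_coord w"
          using fibre_coord_X(1)[OF v] by (auto simp: w_def[symmetric] fibre_map_def forward_index_def split: if_splits)
        then have "fibre_coord w < real m" using lt by simp
        then obtain n where "1 \<le> past_returns \<alpha> n w" using Suc w by blast
        then have "1 \<le> past_returns \<alpha> (Suc n) v" by (simp add: w_def)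
        then show ?thesis by blast
      next
        case 3
        then have "1 \<le> past_returns \<alpha> 1 v" by (simp add: w_def)
        then show ?thesis by blast
      qed
    qed
  qed
  moreover obtain m :: nat where "fibre_coord v < real m" using reals_Archimedean2 by blast
  ultimately show ?thesis using assms by blast
qed

lemma X_funpow_inv: "v \<in> X \<Longrightarrow> (farey_inv \<alpha> ^^ n) v \<in> X"
  by (induction n) (auto simp: X_facts)

lemma past_returns_unbounded:
  assumes "v \<in> X"
  shows "\<exists>n. m \<le> past_returns \<alpha> n v"
proof (induction m)
  case (Suc m)
  then obtain n where n: "m \<le> past_returns \<alpha> n v" by blast
  obtain k where "1 \<le> past_returns \<alpha> k ((farey_inv \<alpha> ^^ n) v)"
    using ex_past_return[OF X_funpow_inv[OF assms]] by blast
  then have "Suc m \<le> past_returns \<alpha> (n + k) v" using n by (simp add: past_returns_add)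
  then show ?case by blast
qed simp

lemma past_approx_tendsto:
  assumes "v \<in> X"
  shows "(\<lambda>n. past_approx \<alpha> n v) \<longlonglongrightarrow> fibre_coord v"
proof (rule LIMSEQ_I)
  fix r :: real assume "0 < r"
  then obtain m :: nat where m: "inverse (real (Suc m)) < r" using reals_Archimedean by blast
  obtain N where N: "Suc m \<le> past_returns \<alpha> N v" using past_returns_unbounded[OF assms] by blast
  show "\<exists>no. \<forall>n\<ge>no. norm (past_approx \<alpha> n v - fibre_coord v) < r"
  proof (intro exI allI impI)
    fix n assume "N \<le> n"
    then have le: "Suc m \<le> past_returns \<alpha> n v" using N past_returns_mono order_trans by blast
    then have "0 < past_returns \<alpha> n v" by simp
    from past_approx_error[OF assms this]
    have "\<bar>fibre_coord v - past_approx \<alpha> n v\<bar> \<le> 1 / real (past_returns \<alpha> n v)" .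
    also have "\<dots> \<le> 1 / real (Suc m)" using le by (intro divide_left_mono) auto
    also have "\<dots> < r" using m by (simp add: inverse_eq_divide)
    finally show "norm (past_approx \<alpha> n v - fibre_coord v) < r" by (simp add: abs_minus_commute)
  qed
qed

text \<open>For the \<sigma>-algebra \<open>M\<close> generated by the past, \<open>fst\<close> and
  \<open>farey_inv\<close> are measurable, hence so are all \<open>past_approx\<close> and their
  limit \<open>fibre_coord\<close>. Then both coordinates are measurable, and the identity from
  \<open>M\<close> to the Borel sets gives the claim with no further null set.\<close>

lemma past_sigma_algebra_borel:
  assumes N: "sets N = sets (restrict_space borel {\<alpha> - 1..<1 / \<alpha>})" and A: "A \<in> sets borel"
  shows "A \<inter> X \<in> past_sigma_algebra fst (farey_fin \<alpha>) X N"
proof -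
  define G where "G = {(farey_fin \<alpha> ^^ n) ` (fst -` B \<inter> X) | n B. B \<in> sets N}"
  have TX: "(farey_fin \<alpha> ^^ n) v \<in> X" if "v \<in> X" for n v
    using that by (induction n) (auto simp: X_facts)
  have G: "G \<subseteq> Pow X" using TX by (auto simp: G_def)
  define M where "M = sigma X G"
  have M: "space M = X" "sets M = sigma_sets X G"
    using G by (simp_all add: M_def space_measure_of sets_measure_of)
  have fst: "fst \<in> measurable M borel"
  proof (rule measurableI)
    fix B :: "real set" assume B: "B \<in> sets borel"
    have J: "fst v \<in> {\<alpha> - 1..<1 / \<alpha>}" if "v \<in> X" for v
      using farey_domain_bounds(4,5)[of "fst v" "snd v"] X_facts(1)[OF that] by auto
    then have eq: "fst -` B \<inter> space M = (farey_fin \<alpha> ^^ 0) ` (fst -` ({\<alpha> - 1..<1 / \<alpha>} \<inter> B) \<inter> X)"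
      unfolding M by auto
    have "{\<alpha> - 1..<1 / \<alpha>} \<inter> B \<in> sets N" unfolding N sets_restrict_space using B by auto
    then have "fst -` B \<inter> space M \<in> G" unfolding eq G_def by blast
    then show "fst -` B \<inter> space M \<in> sets M" unfolding M(2) by blast
  qed simp
  have S: "farey_inv \<alpha> \<in> measurable M M"
  proof -
    have "farey_inv \<alpha> \<in> measurable M (measure_of X G (emeasure M))"
    proof (rule measurable_measure_of[OF G])
      show "farey_inv \<alpha> \<in> space M \<rightarrow> X" using X_facts by (auto simp: M)
      fix C assume "C \<in> G"
      then obtain n B where C: "C = (farey_fin \<alpha> ^^ n) ` (fst -` B \<inter> X)" "B \<in> sets N" by (auto simp: G_def)
      have CX: "C \<subseteq> X" using C(1) TX by blast
      \<comment> \<open>Pulling back by the inverse pushes a generator one step forward, from n to n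
        + 1.\<close>
      have "farey_inv \<alpha> -` C \<inter> X = farey_fin \<alpha> ` C"
      proof (intro equalityI subsetI)
        fix u assume "u \<in> farey_inv \<alpha> -` C \<inter> X"
        then have "farey_inv \<alpha> u \<in> C" "u = farey_fin \<alpha> (farey_inv \<alpha> u)" using X_facts(5) by auto
        then show "u \<in> farey_fin \<alpha> ` C" by blast
      next
        fix u assume "u \<in> farey_fin \<alpha> ` C"
        then obtain w where "w \<in> C" "u = farey_fin \<alpha> w" by blast
        then show "u \<in> farey_inv \<alpha> -` C \<inter> X" using CX X_facts(2,4)[of w] by auto
      qed
      also have "\<dots> = (farey_fin \<alpha> ^^ Suc n) ` (fst -` B \<inter> X)" unfolding C by (simp add: image_image)
      finally have "farey_inv \<alpha> -` C \<inter> X \<in> G" using C(2) unfolding G_def by blast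
      then show "farey_inv \<alpha> -` C \<inter> space M \<in> sets M" unfolding M by blast
    qed
    moreover have "sets (measure_of X G (emeasure M)) = sets M" using G M(2) by (simp add: sets_measure_of)
    ultimately show ?thesis using measurable_cong_sets by blast
  qed
  have approx: "past_approx \<alpha> n \<in> borel_measurable M" for n
  proof (induction n)
    case (Suc n)
    have [measurable]: "(\<lambda>v. fst (farey_inv \<alpha> v)) \<in> borel_measurable M" "(\<lambda>v. past_approx \<alpha> n (farey_inv \<alpha> v)) \<in> borel_measurable M"
      using measurable_compose[OF S fst] measurable_compose[OF S Suc] by auto
    show ?case unfolding past_approx.simps(2)[abs_def] fibre_map_def by measurable
  qed simp
  have [measurable]: "fibre_coord \<in> borel_measurable M"
    by (rule borel_measurable_LIMSEQ_real[where u = "past_approx \<alpha>", OF _ approx]) (simp add: M past_approx_tendsto)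
  have "(\<lambda>v. inverse (- fibre_coord v)) \<in> borel_measurable M" by measurable
  then have snd: "snd \<in> borel_measurable M" by (simp add: fibre_coord_def[abs_def])
  have "(\<lambda>v. (fst v, snd v)) \<in> measurable M (borel \<Otimes>\<^sub>M borel)"
    by (rule measurable_Pair[OF fst snd])
  then have "(\<lambda>v. v) \<in> borel_measurable M" unfolding borel_prod by simp
  from measurable_sets[OF this A] show ?thesis
    unfolding past_sigma_algebra_def G_def[symmetric] M by (simp add: vimage_def Int_def)
qed

end

end

section \<open>Transfer to the extended plane\<close>

lemma sets_mu: "A \<in> sets (mu \<alpha>) \<longleftrightarrow> A \<in> sets borel \<and> A \<subseteq> V \<alpha>"
  unfolding mu_def lborel_ext_def using measurable_V[of \<alpha>] by (subst sets_restrict_space_iff) auto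

lemma space_mu [simp]: "space (mu \<alpha>) = V \<alpha>"
  by (simp add: mu_def lborel_ext_def space_restrict_space)

text \<open>On the extended plane the density measure is the image of \<open>hyp\<close> under
  \<open>emb\<close>, so the lines at infinity carry no mass and all computations return to the real
  plane.\<close>

lemma emeasure_mu:
  assumes "A \<in> sets (mu \<alpha>)"
  shows "emeasure (mu \<alpha>) A = emeasure hyp (emb -` A)"
proof -
  have A: "A \<in> sets borel" "A \<subseteq> V \<alpha>" using assms by (auto simp: sets_mu)
  have e: "emb \<in> measurable lborel borel" by simp
  have d: "(\<lambda>(x, y). ennreal (1 / (x - real_of_ereal y)\<^sup>2)) \<in> borel_measurable (borel :: (real \<times> ereal) measure)"
    unfolding borel_prod[symmetric] by measurable
  have "density lborel_ext (\<lambda>(x, y). ennreal (1 / (x - real_of_ereal y)\<^sup>2)) = distr hyp borel emb"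
  proof -
    have "lborel_ext = distr lborel borel emb"
      by (simp add: lborel_ext_def emb_def[abs_def] case_prod_unfold)
    moreover have "density (distr lborel borel emb) (\<lambda>(x, y). ennreal (1 / (x - real_of_ereal y)\<^sup>2))
        = distr (density lborel (\<lambda>v. case emb v of (x, y) \<Rightarrow> ennreal (1 / (x - real_of_ereal y)\<^sup>2))) borel emb"
      by (rule density_distr[OF d e])
    moreover have "(\<lambda>v. case emb v of (x, y) \<Rightarrow> ennreal (1 / (x - real_of_ereal y)\<^sup>2)) = (\<lambda>(x, y). ennreal (1 / (x - y)\<^sup>2))"
      by (simp add: fun_eq_iff emb_def)
    ultimately show ?thesis by (simp only: hyp_def)
  qed
  then have "emeasure (mu \<alpha>) A = emeasure (distr hyp borel emb) A"
    unfolding mu_def using A measurable_V by (simp add: emeasure_restrict_space)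
  also have "\<dots> = emeasure hyp (emb -` A)"
  proof -
    have "emb \<in> measurable hyp borel" by measurable
    from emeasure_distr[OF this A(1)] show ?thesis by simp
  qed
  finally show ?thesis .
qed

lemma sets_nu: "sets (nu \<alpha>) = sets (restrict_space borel {\<alpha> - 1..<1 / \<alpha>})"
  unfolding nu_def by (intro sets_restrict_space_cong) simp

lemma measurable_fst_mu: "fst \<in> measurable (mu \<alpha>) borel"
proof -
  have "fst \<in> measurable (borel :: (real \<times> ereal) measure) borel"
    unfolding borel_prod[symmetric] by measurable
  then show ?thesis unfolding mu_def lborel_ext_def
    by (intro measurable_restrict_space1) simp
qed

lemma emeasure_nu:
  assumes "B \<in> sets (nu \<alpha>)"
  shows "fst -` B \<inter> V \<alpha> \<in> sets (mu \<alpha>)" "emeasure (nu \<alpha>) B = emeasure (mu \<alpha>) (fst -` B \<inter> V \<alpha>)"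
proof -
  have B: "B \<in> sets borel" "B \<subseteq> {\<alpha> - 1..<1 / \<alpha>}"
    using assms by (auto simp: sets_nu sets_restrict_space_iff)
  show "fst -` B \<inter> V \<alpha> \<in> sets (mu \<alpha>)" using measurable_sets[OF measurable_fst_mu B(1)] by simp
  show "emeasure (nu \<alpha>) B = emeasure (mu \<alpha>) (fst -` B \<inter> V \<alpha>)"
    unfolding nu_def using B measurable_fst_mu
    by (subst emeasure_restrict_space) (auto simp: emeasure_distr)
qed

lemma measurable_farey_hat: "farey_hat \<alpha> \<in> borel_measurable borel"
  unfolding farey_hat_def Let_def quot_def borel_prod[symmetric] by measurable

section \<open>The planar map on \<open>V\<close> and \<sigma>-finiteness\<close>

context
  fixes \<alpha> :: real
  assumes \<alpha>: "0 < \<alpha>" "\<alpha> < 1 / 2"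
begin

text \<open>At generic points no denominator vanishes, so \<open>quot\<close> has its finite value,
  and x = 1 / (1 + \<alpha>), where \<open>farey\<close> and \<open>farey_hat\<close> choose
  different branches, does not occur.\<close>

lemma farey_hat_emb:
  assumes "v \<in> farey_domain \<alpha>"
  shows "farey_hat \<alpha> (emb v) = emb (farey_fin \<alpha> v)" "fst (farey_fin \<alpha> v) = farey \<alpha> (fst v)"
proof -
  obtain x y where v: "v = (x, y)" by (cases v)
  note bd = farey_domain_bounds[OF \<alpha> assms[unfolded v]]
  have ne: "x \<noteq> 0" "y \<noteq> 0" "1 + x \<noteq> 0" "1 + y \<noteq> 0" "1 - x \<noteq> 0" "1 - y \<noteq> 0"
    using bd(1,2) mobius_pts_shift(5)[of x \<alpha>] mobius_pts_shift(5)[of y \<alpha>]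
      mobius_pts_consts(2)[of \<alpha>] mobius_pts_consts(1)[of \<alpha>] by (metis diff_eq_eq add_0)+
  have "inverse (1 + \<alpha>) \<in> mobius_pts \<alpha>" by simp
  then have nx: "x \<noteq> 1 / (1 + \<alpha>)" using bd(1) by (auto simp: inverse_eq_divide)
  have f: "inverse (- inverse z - 1) = - z / (1 + z)" "inverse (inverse z - 1) = z / (1 - z)" "inverse z - 1 = (1 - z) / z"
    if "z \<noteq> 0" "1 + z \<noteq> 0" "1 - z \<noteq> 0" for z :: real
  proof -
    show 3: "inverse z - 1 = (1 - z) / z" using that by (simp add: field_simps)
    show "inverse (inverse z - 1) = z / (1 - z)" unfolding 3 by simp
    have h: "- inverse z - 1 = - ((1 + z) / z)" using that by (simp add: field_simps)
    have "inverse (- inverse z - 1) = - (z / (1 + z))" unfolding h inverse_minus_eq inverse_divide ..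
    then show "inverse (- inverse z - 1) = - z / (1 + z)" by simp
  qed
  note f = f[OF ne(1,3,5)] f[OF ne(2,4,6)]
  show "farey_hat \<alpha> (emb v) = emb (farey_fin \<alpha> v)"
    using ne f by (simp add: farey_hat_def emb_def v farey_fin_def forward_index_def branch_def
      inv2_def add2_def neg2_def quot_def Let_def)
  show "fst (farey_fin \<alpha> v) = farey \<alpha> (fst v)"
    using f nx by (auto simp: farey_def v farey_fin_def forward_index_def branch_def
      inv2_def add2_def neg2_def)
qed

lemma vimage_emb_V:
  assumes X: "invertible_part \<alpha> X"
  shows "X \<subseteq> emb -` V \<alpha>" "emb -` V \<alpha> - X \<in> null_sets hyp"
proof -
  show "X \<subseteq> emb -` V \<alpha>" using X by (auto simp: invertible_part_def farey_domain_eq[OF \<alpha>])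
  have "emb -` V \<alpha> - X \<subseteq> (farey_domain \<alpha> - X) \<union> - generic \<alpha>" by (auto simp: farey_domain_eq[OF \<alpha>])
  moreover have "emb -` V \<alpha> - X \<in> sets hyp"
    using measurable_sets_borel[OF emb_measurable measurable_V] X_borel[OF \<alpha> X] by simp
  moreover have "(farey_domain \<alpha> - X) \<union> - generic \<alpha> \<in> null_sets hyp"
    using X null_sets_not_generic by (auto simp: invertible_part_def)
  ultimately show "emb -` V \<alpha> - X \<in> null_sets hyp" by (blast intro: null_sets_subset)
qed

lemma emeasure_hyp_Int_X:
  assumes X: "invertible_part \<alpha> X" and A: "A \<in> sets borel" "A \<subseteq> emb -` V \<alpha>"
  shows "emeasure hyp A = emeasure hyp (A \<inter> X)"
proof -
  have "A \<inter> X = A - (emb -` V \<alpha> - X)" using A(2) by auto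
  then show ?thesis using emeasure_Diff_null_set[OF vimage_emb_V(2)[OF X]] A by simp
qed

lemma emb_image_borel:
  assumes C: "C \<in> sets borel"
  shows "emb ` C \<in> sets borel"
proof -
  have m: "(\<lambda>v. (fst v, real_of_ereal (snd v))) \<in> borel_measurable (borel :: (real \<times> ereal) measure)"
    unfolding borel_prod[symmetric] by measurable
  have "{v \<in> space (borel \<Otimes>\<^sub>M borel). \<bar>snd v\<bar> \<noteq> \<infinity>} \<in> sets (borel \<Otimes>\<^sub>M borel :: (real \<times> ereal) measure)"
    by measurable
  then have "{v. \<bar>snd v\<bar> \<noteq> \<infinity>} \<in> sets (borel \<Otimes>\<^sub>M borel :: (real \<times> ereal) measure)"
    by (simp add: space_pair_measure)
  then have f: "{v. \<bar>snd v\<bar> \<noteq> \<infinity>} \<in> sets (borel :: (real \<times> ereal) measure)"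
    by (simp only: borel_prod)
  have "emb ` C = (\<lambda>v. (fst v, real_of_ereal (snd v))) -` C \<inter> {v. \<bar>snd v\<bar> \<noteq> \<infinity>}"
  proof (intro equalityI subsetI)
    fix v assume "v \<in> (\<lambda>v. (fst v, real_of_ereal (snd v))) -` C \<inter> {v. \<bar>snd v\<bar> \<noteq> \<infinity>}"
    then have "(fst v, real_of_ereal (snd v)) \<in> C" "v = emb (fst v, real_of_ereal (snd v))"
      by (auto simp: emb_def ereal_real prod_eq_iff)
    then show "v \<in> emb ` C" by blast
  qed (auto simp: emb_def)
  then show ?thesis using measurable_sets_borel[OF m C] f by simp
qed

lemma emb_image_X:
  assumes X: "invertible_part \<alpha> X"
  shows "emb ` X \<in> sets (mu \<alpha>)" "V \<alpha> - emb ` X \<in> null_sets (mu \<alpha>)"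
proof -
  show s: "emb ` X \<in> sets (mu \<alpha>)"
    using emb_image_borel[OF X_borel[OF \<alpha> X]] vimage_emb_V(1)[OF X] by (auto simp: sets_mu)
  then have s': "V \<alpha> - emb ` X \<in> sets (mu \<alpha>)" using measurable_V by (auto simp: sets_mu)
  have "emb -` (V \<alpha> - emb ` X) = emb -` V \<alpha> - X"
    by (intro set_eqI) (simp add: inj_image_mem_iff[OF emb_inj])
  then show "V \<alpha> - emb ` X \<in> null_sets (mu \<alpha>)"
    using emeasure_mu[OF s'] null_setsD1[OF vimage_emb_V(2)[OF X]] s' by (intro null_setsI) simp_all
qed

text \<open>Infinite mass can accumulate only at the origin: up to null sets the domain lies in y <
  -1 < \<alpha> - 1 for x < 0 and in y < 0 for x > 0. Cutting out 0 < x < 1 / (n + 1) leaves two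
  strips away from the diagonal.\<close>

lemma finite_slices:
  obtains I :: "nat \<Rightarrow> real set" where "\<And>n. I n \<in> sets (nu \<alpha>)" "(\<Union>n. I n) = {\<alpha> - 1..<1 / \<alpha>}"
    "\<And>n. emeasure (nu \<alpha>) (I n) < \<infinity>"
proof -
  define I where "I n = {\<alpha> - 1..0} \<union> {1 / real (Suc n)..<1 / \<alpha>}" for n
  have \<alpha>1: "1 < 1 / \<alpha>" using \<alpha> by simp
  have "I n \<subseteq> {\<alpha> - 1..<1 / \<alpha>}" for n
  proof -
    have n: "0 < 1 / real (Suc n)" by simp
    show ?thesis
    proof
      fix x assume "x \<in> I n"
      then consider "\<alpha> - 1 \<le> x" "x \<le> 0" | "1 / real (Suc n) \<le> x" "x < 1 / \<alpha>" by (auto simp: I_def)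
      then have "\<alpha> - 1 \<le> x \<and> x < 1 / \<alpha>" by cases (use \<alpha> \<alpha>1 n in linarith)+
      then show "x \<in> {\<alpha> - 1..<1 / \<alpha>}" by simp
    qed
  qed
  then have s: "I n \<in> sets (nu \<alpha>)" for n by (auto simp: sets_nu sets_restrict_space_iff I_def)
  have "{\<alpha> - 1..<1 / \<alpha>} \<subseteq> (\<Union>n. I n)"
  proof
    fix x assume x: "x \<in> {\<alpha> - 1..<1 / \<alpha>}"
    show "x \<in> (\<Union>n. I n)"
    proof (cases "x \<le> 0")
      case True then show ?thesis using x by (auto simp: I_def)
    next
      case False
      then obtain n where "inverse (real (Suc n)) < x" using reals_Archimedean[of x] by auto
      then have "x \<in> I n" using x by (auto simp: I_def inverse_eq_divide)
      then show ?thesis by blast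
    qed
  qed
  with s have U: "(\<Union>n. I n) = {\<alpha> - 1..<1 / \<alpha>}"
    by (auto simp: sets_nu sets_restrict_space_iff)
  have "emeasure (nu \<alpha>) (I n) < \<infinity>" for n
  proof -
    define C where "C = {\<alpha> - 1..0} \<times> {..- 1 :: real}"
    define D where "D = {1 / real (Suc n)..1 / \<alpha>} \<times> {..0 :: real}"
    have CD: "C \<in> sets hyp" "D \<in> sets hyp"
      unfolding C_def D_def by (auto intro!: borel_closed closed_Times)
    have sub: "emb -` (fst -` I n \<inter> V \<alpha>) \<subseteq> C \<union> D \<union> - generic \<alpha>"
    proof
      fix v assume a: "v \<in> emb -` (fst -` I n \<inter> V \<alpha>)"
      show "v \<in> C \<union> D \<union> - generic \<alpha>"
      proof (cases "v \<in> generic \<alpha>")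
        case True
        then have d: "(fst v, snd v) \<in> farey_domain \<alpha>" using a by (simp add: farey_domain_eq[OF \<alpha>])
        have x: "fst v \<in> I n" using a by (simp add: emb_def)
        note bd = farey_domain_bounds[OF \<alpha> d]
        have "fst v \<noteq> 0" using bd(1) by auto
        then show ?thesis using x bd(3-6) by (auto simp: I_def C_def D_def mem_Times_iff)
      qed simp
    qed
    have "emeasure (nu \<alpha>) (I n) = emeasure hyp (emb -` (fst -` I n \<inter> V \<alpha>))"
      using emeasure_nu[OF s] emeasure_mu by simp
    also have "\<dots> \<le> emeasure hyp (C \<union> D \<union> - generic \<alpha>)"
      using CD null_setsD2[OF null_sets_not_generic] by (intro emeasure_mono sub) auto
    also have "\<dots> = emeasure hyp (C \<union> D)"
      using CD null_sets_not_generic by (intro emeasure_Un_null_set) auto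
    also have "\<dots> \<le> emeasure hyp C + emeasure hyp D" using CD by (intro emeasure_subadditive)
    also have "\<dots> < \<infinity>" unfolding C_def D_def
      using hyp_strip_finite[of "- 1" "\<alpha> - 1" 0] hyp_strip_finite[of 0 "1 / real (Suc n)" "1 / \<alpha>"] \<alpha> by simp
    finally show ?thesis .
  qed
  then show thesis using that s U by blast
qed

lemma sigma_finite_nu: "sigma_finite_measure (nu \<alpha>)"
proof -
  obtain I :: "nat \<Rightarrow> real set" where I: "\<And>n. I n \<in> sets (nu \<alpha>)" "(\<Union>n. I n) = {\<alpha> - 1..<1 / \<alpha>}"
    "\<And>n. emeasure (nu \<alpha>) (I n) < \<infinity>" using finite_slices by blast
  have "space (nu \<alpha>) = {\<alpha> - 1..<1 / \<alpha>}" by (simp add: nu_def space_restrict_space)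
  then show ?thesis using I by (intro sigma_finite_measure.intro exI[of _ "range I"]) (auto simp: less_top)
qed

text \<open>The slices are only known to cover the image of \<open>X\<close>; the rest of
  \<open>V\<close> is the null set \<open>Z\<close>, which completes the cover.\<close>

lemma sigma_finite_mu: "sigma_finite_measure (mu \<alpha>)"
proof -
  obtain I :: "nat \<Rightarrow> real set" where I: "\<And>n. I n \<in> sets (nu \<alpha>)" "(\<Union>n. I n) = {\<alpha> - 1..<1 / \<alpha>}"
    "\<And>n. emeasure (nu \<alpha>) (I n) < \<infinity>" using finite_slices by blast
  obtain X where X: "invertible_part \<alpha> X" using ex_invertible_part[OF \<alpha>] by blast
  define Z where "Z = V \<alpha> - emb ` X"
  define J where "J n = fst -` I n \<inter> V \<alpha>" for n
  have Z: "Z \<in> null_sets (mu \<alpha>)" using emb_image_X[OF X] by (simp add: Z_def)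
  have J: "J n \<in> sets (mu \<alpha>)" "emeasure (mu \<alpha>) (J n) < \<infinity>" for n
    using emeasure_nu[OF I(1)] I(3) by (auto simp: J_def)
  have "V \<alpha> \<subseteq> Z \<union> (\<Union>n. J n)"
  proof
    fix v assume v: "v \<in> V \<alpha>"
    show "v \<in> Z \<union> (\<Union>n. J n)"
    proof (cases "v \<in> emb ` X")
      case True
      then obtain w where w: "w \<in> X" "v = emb w" by blast
      then have "(fst w, snd w) \<in> farey_domain \<alpha>" using X_facts(1)[OF \<alpha> X] by simp
      then have "fst v \<in> (\<Union>n. I n)"
        using farey_domain_bounds(4,5)[OF \<alpha>, of "fst w" "snd w"] w(2) by (auto simp: I(2) emb_def)
      then show ?thesis using v by (auto simp: J_def)
    qed (use v in \<open>simp add: Z_def\<close>)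
  qed
  moreover have "Z \<subseteq> V \<alpha>" "J n \<subseteq> V \<alpha>" for n by (auto simp: Z_def J_def)
  ultimately have "(\<Union>(insert Z (range J))) = V \<alpha>" by auto
  then show ?thesis using Z J
    by (intro sigma_finite_measure.intro exI[of _ "insert Z (range J)"]) (auto simp: less_top)
qed

end

theorem theorem1:
  fixes \<alpha> :: real
  assumes "0 < \<alpha>" and "\<alpha> < 1 / 2"
  shows "represents_natural_extension fst (mu \<alpha>) (farey_hat \<alpha>) (nu \<alpha>) (farey \<alpha>)"
proof -
  note \<alpha> = assms
  obtain X where X: "invertible_part \<alpha> X" using ex_invertible_part[OF \<alpha>] by blast
  note Xf = X_facts[OF \<alpha> X]
  \<comment> \<open>The set of full measure required by the definition of a natural extension; on it
    \<open>farey_hat\<close> is conjugate to \<open>farey_fin\<close> on \<open>X\<close> through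
    \<open>emb\<close>.\<close>
  define Y where "Y = emb ` X"
  have Y: "Y \<in> sets (mu \<alpha>)" "V \<alpha> - Y \<in> null_sets (mu \<alpha>)"
    using emb_image_X[OF \<alpha> X] by (simp_all add: Y_def)
  have hat: "farey_hat \<alpha> (emb v) = emb (farey_fin \<alpha> v)" if "v \<in> X" for v
    using farey_hat_emb(1)[OF \<alpha> Xf(1)[OF that]] .
  have AE: "AE v in mu \<alpha>. P v" if "\<And>v. v \<in> X \<Longrightarrow> P (emb v)" for P
    by (rule AE_I'[OF Y(2)]) (use that in \<open>auto simp: Y_def\<close>)
  have funpow: "(farey_hat \<alpha> ^^ n) (emb v) = emb ((farey_fin \<alpha> ^^ n) v) \<and> (farey_fin \<alpha> ^^ n) v \<in> X"
    if "v \<in> X" for n v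
    using that by (induction n) (auto simp: hat Xf)
  have img: "(farey_hat \<alpha> ^^ n) ` (fst -` B \<inter> Y) = emb ` ((farey_fin \<alpha> ^^ n) ` (fst -` B \<inter> X))" for n B
  proof -
    have "fst -` B \<inter> Y = emb ` (fst -` B \<inter> X)" by (auto simp: Y_def emb_def)
    then show ?thesis using funpow by (auto simp: image_image intro!: image_cong)
  qed
  have pres: "preserves_measure (mu \<alpha>) (farey_hat \<alpha>)"
    unfolding preserves_measure_def
  proof
    fix A assume A: "A \<in> sets (mu \<alpha>)"
    have A': "A \<in> sets borel" "A \<subseteq> V \<alpha>" using A by (auto simp: sets_mu)
    define B where "B = farey_hat \<alpha> -` A \<inter> V \<alpha>"
    have B: "B \<in> sets (mu \<alpha>)"
      unfolding sets_mu B_def using measurable_sets_borel[OF measurable_farey_hat A'(1)] measurable_V by auto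
    have m: "emb -` C \<in> sets borel" "emb -` C \<subseteq> emb -` V \<alpha>" if "C \<in> sets (mu \<alpha>)" for C
      using that measurable_sets_borel[OF emb_measurable] by (auto simp: sets_mu)
    have "emeasure (mu \<alpha>) B = emeasure hyp (emb -` B \<inter> X)"
      using emeasure_mu[OF B] emeasure_hyp_Int_X[OF \<alpha> X m[OF B]] by simp
    also have "emb -` B \<inter> X = farey_fin \<alpha> -` (emb -` A) \<inter> X"
    proof (intro set_eqI)
      show "v \<in> emb -` B \<inter> X \<longleftrightarrow> v \<in> farey_fin \<alpha> -` (emb -` A) \<inter> X" for v
        using hat[of v] vimage_emb_V(1)[OF \<alpha> X] by (cases "v \<in> X") (auto simp: B_def)
    qed
    also have "emeasure hyp \<dots> = emeasure hyp (emb -` A \<inter> X)"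
      by (rule invertible_part_preserves[OF \<alpha> X m(1)[OF A]])
    also have "\<dots> = emeasure (mu \<alpha>) A"
      using emeasure_mu[OF A] emeasure_hyp_Int_X[OF \<alpha> X m[OF A]] by simp
    finally show "farey_hat \<alpha> -` A \<inter> space (mu \<alpha>) \<in> sets (mu \<alpha>) \<and>
        emeasure (mu \<alpha>) (farey_hat \<alpha> -` A \<inter> space (mu \<alpha>)) = emeasure (mu \<alpha>) A"
      using B by (simp add: B_def)
  qed
  have AE1: "AE v in mu \<alpha>. fst v \<in> space (nu \<alpha>)"
  proof (rule AE)
    fix v assume "v \<in> X"
    then have "(fst v, snd v) \<in> farey_domain \<alpha>" using Xf(1) by simp
    then show "fst (emb v) \<in> space (nu \<alpha>)"
      using farey_domain_bounds(4,5)[OF \<alpha>, of "fst v" "snd v"]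
      by (simp add: nu_def space_restrict_space emb_def)
  qed
  have AE2: "AE v in mu \<alpha>. fst (farey_hat \<alpha> v) = farey \<alpha> (fst v)"
    by (rule AE) (use farey_hat_emb[OF \<alpha> Xf(1)] in \<open>simp add: emb_def\<close>)
  have bij: "bij_betw (farey_hat \<alpha>) Y Y"
    unfolding bij_betw_def
  proof
    show "inj_on (farey_hat \<alpha>) Y"
    proof (rule inj_onI)
      fix p q assume "p \<in> Y" "q \<in> Y" and eq: "farey_hat \<alpha> p = farey_hat \<alpha> q"
      then obtain v w where v: "v \<in> X" "p = emb v" and w: "w \<in> X" "q = emb w" by (auto simp: Y_def)
      have "emb (farey_fin \<alpha> v) = emb (farey_fin \<alpha> w)" using eq v w hat by simp
      then have "farey_fin \<alpha> v = farey_fin \<alpha> w" by (rule injD[OF emb_inj])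
      then have "v = w" using Xf(4)[OF v(1)] Xf(4)[OF w(1)] by metis
      then show "p = q" using v w by simp
    qed
    show "farey_hat \<alpha> ` Y = Y"
    proof (intro equalityI subsetI)
      fix w assume "w \<in> Y"
      then obtain v where v: "v \<in> X" "w = emb v" by (auto simp: Y_def)
      then have "w = farey_hat \<alpha> (emb (farey_inv \<alpha> v))" using hat Xf(3,5) by simp
      then show "w \<in> farey_hat \<alpha> ` Y" using Xf(3) v by (auto simp: Y_def)
    qed (use hat Xf(2) in \<open>force simp: Y_def\<close>)
  qed
  define G where "G = {(farey_hat \<alpha> ^^ n) ` (fst -` B \<inter> Y) | n B. B \<in> sets (nu \<alpha>)}"
  have gen: "\<exists>A'\<in>past_sigma_algebra fst (farey_hat \<alpha>) Y (nu \<alpha>). eq_mod_null (mu \<alpha>) A A'" if A: "A \<in> sets (mu \<alpha>)" for A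
  proof -
    have "emb ` C \<in> past_sigma_algebra fst (farey_hat \<alpha>) Y (nu \<alpha>)"
      if "C \<in> past_sigma_algebra fst (farey_fin \<alpha>) X (nu \<alpha>)" for C
      using that unfolding past_sigma_algebra_def
    proof (induction rule: sigma_sets.induct)
      case (Basic C)
      then obtain n B where "C = (farey_fin \<alpha> ^^ n) ` (fst -` B \<inter> X)" "B \<in> sets (nu \<alpha>)" by blast
      then have "emb ` C = (farey_hat \<alpha> ^^ n) ` (fst -` B \<inter> Y)" "B \<in> sets (nu \<alpha>)" using img by auto
      then show ?case by (intro sigma_sets.Basic) blast
    next
      case Empty then show ?case by (simp add: sigma_sets.Empty)
    next
      case (Compl C)
      have "emb ` (X - C) = Y - emb ` C" using emb_inj by (simp add: Y_def image_set_diff)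
      then show ?case using Compl.IH by (simp add: sigma_sets.Compl)
    next
      case (Union C) then show ?case by (simp add: image_UN sigma_sets.Union)
    qed
    moreover have "emb -` A \<in> sets borel" using A measurable_sets_borel[OF emb_measurable] by (auto simp: sets_mu)
    then have "emb -` A \<inter> X \<in> past_sigma_algebra fst (farey_fin \<alpha>) X (nu \<alpha>)"
      by (rule past_sigma_algebra_borel[OF \<alpha> X sets_nu])
    ultimately have "emb ` (emb -` A \<inter> X) \<in> past_sigma_algebra fst (farey_hat \<alpha>) Y (nu \<alpha>)" by blast
    moreover have "emb ` (emb -` A \<inter> X) = A \<inter> Y" by (auto simp: Y_def)
    moreover have "eq_mod_null (mu \<alpha>) A (A \<inter> Y)"
      unfolding eq_mod_null_def using Y(2) A by (intro bexI[of _ "V \<alpha> - Y"]) (auto simp: sets_mu)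
    ultimately show ?thesis by metis
  qed
  \<comment> \<open>This direction is exact, so A = A' serves as witness: forward images of Borel
    subsets of \<open>X\<close> are preimages under the Borel map \<open>farey_inv\<close>, hence
    Borel.\<close>
  have "A' \<in> sets (mu \<alpha>)" if "A' \<in> past_sigma_algebra fst (farey_hat \<alpha>) Y (nu \<alpha>)" for A'
  proof -
    have "G \<subseteq> sets (mu \<alpha>)"
    proof
      fix C assume "C \<in> G"
      then obtain n B where C: "C = (farey_hat \<alpha> ^^ n) ` (fst -` B \<inter> Y)" and B: "B \<in> sets (nu \<alpha>)" by (auto simp: G_def)
      show "C \<in> sets (mu \<alpha>)"
        unfolding C
      proof (induction n)
        case 0
        have "fst -` B \<inter> Y = (fst -` B \<inter> V \<alpha>) \<inter> Y" using Y(1) by (auto simp: sets_mu)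
        then show ?case using emeasure_nu(1)[OF B] Y(1) by auto
      next
        case (Suc n)
        define E where "E = (farey_fin \<alpha> ^^ n) ` (fst -` B \<inter> X)"
        have EX: "E \<subseteq> X" using funpow by (auto simp: E_def)
        have "emb ` E \<in> sets (mu \<alpha>)" using Suc unfolding img E_def .
        then have "emb -` (emb ` E) \<in> sets borel" using measurable_sets_borel[OF emb_measurable] by (auto simp: sets_mu)
        then have "E \<in> sets borel" using emb_inj by (simp add: inj_vimage_image_eq)
        then have "farey_inv \<alpha> -` E \<inter> X \<in> sets borel"
          using measurable_sets_borel[OF borel_measurable_farey_inv] X_borel[OF \<alpha> X] by auto
        moreover have "farey_fin \<alpha> ` E = farey_inv \<alpha> -` E \<inter> X"
        proof (intro equalityI subsetI)
          fix u assume "u \<in> farey_fin \<alpha> ` E"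
          then obtain w where "w \<in> E" "u = farey_fin \<alpha> w" by blast
          then show "u \<in> farey_inv \<alpha> -` E \<inter> X" using EX Xf(2,4)[of w] by auto
        next
          fix u assume "u \<in> farey_inv \<alpha> -` E \<inter> X"
          then have "farey_inv \<alpha> u \<in> E" "u = farey_fin \<alpha> (farey_inv \<alpha> u)" using Xf(5) by auto
          then show "u \<in> farey_fin \<alpha> ` E" by blast
        qed
        ultimately have "emb ` (farey_fin \<alpha> ` E) \<in> sets borel" by (simp add: emb_image_borel[OF \<alpha>])
        moreover have "emb ` (farey_fin \<alpha> ` E) \<subseteq> V \<alpha>" using EX Xf(2) vimage_emb_V(1)[OF \<alpha> X] by blast
        moreover have "emb ` (farey_fin \<alpha> ` E) = (farey_hat \<alpha> ^^ Suc n) ` (fst -` B \<inter> Y)"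
          unfolding img E_def by (simp add: image_image)
        ultimately show ?case by (metis sets_mu)
      qed
    qed
    moreover have "A' \<in> sigma_sets Y G" using that by (simp add: past_sigma_algebra_def G_def)
    ultimately show ?thesis using sets.sigma_sets_subset'[of G "mu \<alpha>" Y] Y(1) by blast
  qed
  moreover have "eq_mod_null (mu \<alpha>) A A" for A
    unfolding eq_mod_null_def by (intro bexI[of _ "{}"]) auto
  ultimately have gen': "\<forall>A'\<in>past_sigma_algebra fst (farey_hat \<alpha>) Y (nu \<alpha>). \<exists>A\<in>sets (mu \<alpha>). eq_mod_null (mu \<alpha>) A A'"
    by blast
  show ?thesis
    unfolding represents_natural_extension_def space_mu
    using sigma_finite_mu[OF \<alpha>] sigma_finite_nu[OF \<alpha>] pres AE1 AE2 emeasure_nu Y bij gen gen' by blast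
qed

end
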